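(* The action of the cubic Cremona transformation $\mathrm{Cr}$ on $\mathcal{L}=\mathcal{L}_3(d,m_1,\dots,m_r)$ is given by $$\mathrm{Cr}(\mathcal{L})=\mathcal{L}_3(d+k,\,m_1+k,\dots,m_4+k,\,m_5,\dots,m_r),$$ where $k=2d-\sum_{i=1}^4 m_i$.
   Context: $\mathcal{L}_3(d,m_1,\dots,m_r)$ denotes the linear system of degree $d$ surfaces of $\mathbb{P}^3$ associated to the sheaf $\mathcal{O}_{\mathbb{P}^3}(d)\otimes\mathcal{I}_Z$, where $Z=\sum m_ip_i$ is a zero-dimensional scheme of fat points. If $X$ is the blow-up of $\mathbb{P}^3$ along $\{p_1,\dots,p_r\}$, the same symbol also denotes the linear system on $X$ associated to $dH-\sum m_iE_i$, where $H$ is the pull-back of a plane and $E_i$ is the exceptional divisor over $p_i$. The cubic Cremona transformation is the rational map associated to the system $\mathcal{L}_3(3,2^4)$ of cubics with four double points, which are the points $p_1,\dots,p_4$; putting these four points in the fundamental (coordinate) points of $\mathbb{P}^3$, it is given by $\mathrm{Cr}:(x_0:x_1:x_2:x_3)\dashrightarrow(x_0^{-1}:x_1^{-1}:x_2^{-1}:x_3^{-1})$. This birational map induces an action on the Picard group of $X$, and the action in the claim is this one. *)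

theory Defs
  imports
    "HOL-Algebra.Free_Abelian_Groups"
    "HOL-Analysis.Finite_Cartesian_Product"
    "HOL-Computational_Algebra.Factorial_Ring"
    "HOL-Library.Numeral_Type"
begin

text \<open>
  The homogeneous coordinate ring of projective 3-space over a field. Its four variables are
  indexed by the type \<open>4\<close>, with elements 0, 1, 2, 3. A point of projective space is given by a
  nonzero representative in \<open>'a ^ 4\<close>.
\<close>

type_synonym 'a quaternary = "(4 \<Rightarrow>\<^sub>0 nat) \<Rightarrow>\<^sub>0 'a"

definition homogeneous :: "nat \<Rightarrow> 'a::zero quaternary \<Rightarrow> bool" where
  "homogeneous d F \<longleftrightarrow>
     (\<forall>\<alpha>\<in>Poly_Mapping.keys F. (\<Sum>i\<in>UNIV. Poly_Mapping.lookup \<alpha> i) = d)"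

definition const :: "'a::zero \<Rightarrow> 'a quaternary" where
  "const c = Poly_Mapping.single 0 c"

definition X :: "4 \<Rightarrow> 'a::zero_neq_one quaternary" where
  "X i = Poly_Mapping.single (Poly_Mapping.single i 1) 1"

definition subst :: "(4 \<Rightarrow> 'a quaternary) \<Rightarrow> 'a::field quaternary \<Rightarrow> 'a quaternary" where
  "subst Y F = (\<Sum>\<alpha>\<in>Poly_Mapping.keys F.
     const (Poly_Mapping.lookup F \<alpha>) * (\<Prod>i\<in>UNIV. Y i ^ Poly_Mapping.lookup \<alpha> i))"

definition same_point :: "'a::field ^ 4 \<Rightarrow> 'a ^ 4 \<Rightarrow> bool" where
  "same_point x y \<longleftrightarrow> (\<exists>c. c \<noteq> 0 \<and> y = (\<chi> i. c * x $ i))"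

text \<open>
  The order of vanishing of a nonzero polynomial along the surface \<open>S = 0\<close>, and at the point \<open>x\<close>:
  the latter is the least degree of a monomial in the Taylor expansion at \<open>x\<close>. For forms it does
  not depend on the representative \<open>x\<close> and equals the multiplicity of the projective surface at
  the point, since the affine cone is locally a product of this surface with a line.
\<close>

definition ord_along :: "'a::field quaternary \<Rightarrow> 'a quaternary \<Rightarrow> nat" where
  "ord_along S F = (GREATEST n. S ^ n dvd F)"

definition mult_at :: "'a::field ^ 4 \<Rightarrow> 'a quaternary \<Rightarrow> nat" where
  "mult_at x F = Min ((\<lambda>\<alpha>. \<Sum>i\<in>UNIV. Poly_Mapping.lookup \<alpha> i) `
     Poly_Mapping.keys (subst (\<lambda>i. X i + const (x $ i)) F))"

text \<open>
  Throughout, \<open>p 1, \<dots>, p r\<close> are the points blown up. A prime divisor of the blow-up is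
  the strict transform of an integral surface, that is, one whose equation is a prime element,
  or an exceptional divisor. It is represented by the order of vanishing of (the
  total transform of) a form along it: this is \<open>ord_along S\<close>, which does not depend on
  the choice of the equation \<open>S\<close> up to a scalar, respectively \<open>mult_at (p i)\<close>.
  The corresponding discrete valuation of the function field takes \<open>F / G\<close>, for forms of the same
  degree, to the difference of the orders of \<open>F\<close> and \<open>G\<close>.
\<close>

type_synonym 'a prime_divisor = "'a quaternary \<Rightarrow> nat"

definition prime_divisors :: "nat \<Rightarrow> (nat \<Rightarrow> 'a::field ^ 4) \<Rightarrow> 'a prime_divisor set" where
  "prime_divisors r p =
     {ord_along S | S. prime_elem S \<and> (\<exists>d. homogeneous d S)} \<union> {mult_at (p i) | i. i \<in> {1..r}}"

definition Div :: "nat \<Rightarrow> (nat \<Rightarrow> 'a::field ^ 4) \<Rightarrow> ('a prime_divisor \<Rightarrow>\<^sub>0 int) monoid" where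
  "Div r p = free_Abelian_group (prime_divisors r p)"

text \<open>
  The pull-back (total transform) to the blow-up of the surface \<open>F = 0\<close>, for a nonzero form \<open>F\<close>;
  only finitely many prime divisors occur in it.
\<close>

definition total_transform ::
    "nat \<Rightarrow> (nat \<Rightarrow> 'a::field ^ 4) \<Rightarrow> 'a quaternary \<Rightarrow> 'a prime_divisor \<Rightarrow>\<^sub>0 int" where
  "total_transform r p F =
     (\<Sum>v | v \<in> prime_divisors r p \<and> v F \<noteq> 0. frag_cmul (int (v F)) (frag_of v))"

text \<open>
  Principal divisors, namely those of the rational functions \<open>F / G\<close>. As the blow-up is smooth,
  its Picard group is the group of divisors modulo the principal ones.
\<close>

definition principal_divisors ::
    "nat \<Rightarrow> (nat \<Rightarrow> 'a::field ^ 4) \<Rightarrow> ('a prime_divisor \<Rightarrow>\<^sub>0 int) set" where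
  "principal_divisors r p = {total_transform r p F - total_transform r p G | F G d.
     homogeneous d F \<and> homogeneous d G \<and> F \<noteq> 0 \<and> G \<noteq> 0}"

definition Pic :: "nat \<Rightarrow> (nat \<Rightarrow> 'a::field ^ 4) \<Rightarrow> ('a prime_divisor \<Rightarrow>\<^sub>0 int) set monoid" where
  "Pic r p = Div r p Mod principal_divisors r p"

text \<open>
  The class of \<open>d H - m\<^sub>1 E\<^sub>1 - \<dots> - m\<^sub>r E\<^sub>r\<close> and the complete linear system of the effective
  divisors in it. The divisor \<open>H\<close> is the pull-back of the plane \<open>X 0 = 0\<close>; all planes are
  linearly equivalent. The degree and the multiplicities may be negative.
\<close>

definition hyperplane :: "nat \<Rightarrow> (nat \<Rightarrow> 'a::field ^ 4) \<Rightarrow> 'a prime_divisor \<Rightarrow>\<^sub>0 int" where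
  "hyperplane r p = total_transform r p (X 0)"

definition exceptional :: "(nat \<Rightarrow> 'a::field ^ 4) \<Rightarrow> nat \<Rightarrow> 'a prime_divisor \<Rightarrow>\<^sub>0 int" where
  "exceptional p i = frag_of (mult_at (p i))"

definition L3_class :: "nat \<Rightarrow> (nat \<Rightarrow> 'a::field ^ 4) \<Rightarrow> int \<Rightarrow> (nat \<Rightarrow> int) \<Rightarrow>
    ('a prime_divisor \<Rightarrow>\<^sub>0 int) set" where
  "L3_class r p d m = principal_divisors r p #>\<^bsub>Div r p\<^esub>
     (frag_cmul d (hyperplane r p) - (\<Sum>i\<in>{1..r}. frag_cmul (m i) (exceptional p i)))"

definition L3 :: "nat \<Rightarrow> (nat \<Rightarrow> 'a::field ^ 4) \<Rightarrow> int \<Rightarrow> (nat \<Rightarrow> int) \<Rightarrow>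
    ('a prime_divisor \<Rightarrow>\<^sub>0 int) set" where
  "L3 r p d m = {D \<in> L3_class r p d m. \<forall>v. Poly_Mapping.lookup D v \<ge> 0}"

text \<open>
  The cubic Cremona transformation
  \<open>(x\<^sub>0 : x\<^sub>1 : x\<^sub>2 : x\<^sub>3) \<mapsto> (1/x\<^sub>0 : 1/x\<^sub>1 : 1/x\<^sub>2 : 1/x\<^sub>3)\<close>, on points outside the
  coordinate planes and, after clearing denominators, as a quadruple of cubic forms.
  Composing with the latter is the pull-back of forms.
\<close>

definition Cr_point :: "'a::field ^ 4 \<Rightarrow> 'a ^ 4" where
  "Cr_point x = (\<chi> i. inverse (x $ i))"

definition Cr_pullback :: "'a::field quaternary \<Rightarrow> 'a quaternary" where
  "Cr_pullback F = subst (\<lambda>i. \<Prod>j\<in>UNIV - {i}. X j) F"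

text \<open>
  The source of the transformation is the blow-up in the coordinate points \<open>p 1, \<dots>, p 4\<close> and in
  \<open>p 5, \<dots>, p r\<close>, the target is the blow-up in \<open>Cr_points p\<close>.
\<close>

definition Cr_points :: "(nat \<Rightarrow> 'a::field ^ 4) \<Rightarrow> nat \<Rightarrow> 'a ^ 4" where
  "Cr_points p i = (if i \<le> 4 then p i else Cr_point (p i))"

text \<open>
  The prime divisor \<open>w\<close> of the target is the image (strict transform) of the prime divisor \<open>v\<close> of
  the source if the valuation of every rational function \<open>F / G\<close> along \<open>w\<close> is the valuation along
  \<open>v\<close> of its pull-back.
\<close>

definition Cr_transform :: "'a::field prime_divisor \<Rightarrow> 'a prime_divisor \<Rightarrow> bool" where
  "Cr_transform v w \<longleftrightarrow> (\<forall>d F G. homogeneous d F \<and> homogeneous d G \<and> F \<noteq> 0 \<and> G \<noteq> 0 \<longrightarrow>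
     int (w F) - int (w G) = int (v (Cr_pullback F)) - int (v (Cr_pullback G)))"

text \<open>
  The induced push-forward of divisors, the linear extension of the strict transform of prime
  divisors; a prime divisor without a strict transform on the target is contracted.
  The action on classes and on linear systems is the image under this map.
\<close>

definition Cr_div :: "nat \<Rightarrow> (nat \<Rightarrow> 'a::field ^ 4) \<Rightarrow>
    ('a prime_divisor \<Rightarrow>\<^sub>0 int) \<Rightarrow> ('a prime_divisor \<Rightarrow>\<^sub>0 int)" where
  "Cr_div r p = frag_extend (\<lambda>v.
     if \<exists>w\<in>prime_divisors r (Cr_points p). Cr_transform v w
     then frag_of (THE w. w \<in> prime_divisors r (Cr_points p) \<and> Cr_transform v w)
     else 0)"

definition Cr :: "nat \<Rightarrow> (nat \<Rightarrow> 'a::field ^ 4) \<Rightarrow>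
    ('a prime_divisor \<Rightarrow>\<^sub>0 int) set \<Rightarrow> ('a prime_divisor \<Rightarrow>\<^sub>0 int) set" where
  "Cr r p C = Cr_div r p ` C"

end

theory Submission
  imports Defs
begin

text \<open>
  Pulling back a form of degree \<open>d\<close> along \<open>Cr\<close> reflects its exponents, \<open>\<alpha> \<mapsto> (d, d, d, d) - \<alpha>\<close>,
  so pulling back twice multiplies by a power of \<open>X\<^sub>0 X\<^sub>1 X\<^sub>2 X\<^sub>3\<close>. Hence \<open>Cr\<close> exchanges the
  coordinate plane \<open>X\<^sub>i = 0\<close> with the exceptional divisor over the \<open>i\<close>-th coordinate point, takes every other
  surface to the surface of the reflected equation, and the exceptional divisor over a general point
  to the one over its image. This is a bijection of prime divisors of the two blow-ups which
  respects differences of valuations, so that it induces an isomorphism of divisor groups which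
  matches principal divisors and effective divisors. The formula for the class is then read off from
  \<open>H \<sim> {X\<^sub>i = 0} + (\<Sum>j\<noteq>i. E\<^sub>j)\<close>, where \<open>j\<close> runs through the other three coordinate points.
\<close>

section \<open>Substitution\<close>

text \<open>The reflection explains \<open>k\<close>. Let \<open>F\<close> have degree
  \<open>d\<close> and multiplicity \<open>m_i\<close> at the \<open>i\<close>-th coordinate point,
  and let no coordinate plane be a component of \<open>F = 0\<close>. The pull-back has degree
  \<open>3d\<close> and contains the \<open>i\<close>-th plane exactly \<open>m_i\<close> times;
  without these planes its degree is \<open>3d - (m_1 + ... + m_4) = d + k\<close>. Its multiplicity
  at each coordinate point is \<open>2d\<close>, and the planes through the \<open>i\<close>-th one
  use up all \<open>m_j\<close> with \<open>j \<noteq> i\<close>, which leaves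
  \<open>m_i + k\<close>. The same \<open>2d\<close> is why \<open>Cr_transform\<close> compares
  only differences: along the exceptional divisor over a coordinate point, the order of the
  pull-back exceeds the order of \<open>F\<close> along the plane by an amount that depends on the
  degree. Uniqueness of strict transforms therefore needs more than that distinct prime divisors are
  distinct functions. They must be told apart by a quotient of two forms of equal degree, which is
  what \<open>separated\<close> expresses.\<close>

abbreviation mdeg :: "(4 \<Rightarrow>\<^sub>0 nat) \<Rightarrow> nat" where
  "mdeg \<alpha> \<equiv> (\<Sum>i\<in>UNIV. Poly_Mapping.lookup \<alpha> i)"

lemma mdeg_add: "mdeg (\<alpha> + \<beta>) = mdeg \<alpha> + mdeg \<beta>"
  by (simp add: lookup_add sum.distrib)

lemma mdeg_single [simp]: "mdeg (Poly_Mapping.single i n) = n"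
proof -
  have "mdeg (Poly_Mapping.single i n) = (\<Sum>j\<in>UNIV. if i = j then n else 0)"
    by (rule sum.cong) (auto simp: lookup_single when_def)
  then show ?thesis by simp
qed

lemma sum_singles:
  "(\<Sum>\<alpha>\<in>Poly_Mapping.keys F. Poly_Mapping.single \<alpha> (Poly_Mapping.lookup F \<alpha>)) = F"
  by (rule poly_mapping_eqI)
     (auto simp: lookup_sum lookup_single when_def in_keys_iff sum.delta)

lemma additive_induct [case_names zero single add]:
  fixes P :: "('b \<Rightarrow>\<^sub>0 'c::comm_monoid_add) \<Rightarrow> bool"
  assumes "P 0" and "\<And>\<alpha> c. P (Poly_Mapping.single \<alpha> c)" and "\<And>F G. P F \<Longrightarrow> P G \<Longrightarrow> P (F + G)"
  shows "P F"
proof -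
  have "P (\<Sum>\<alpha>\<in>A. Poly_Mapping.single \<alpha> (Poly_Mapping.lookup F \<alpha>))" for A
    by (induction A rule: infinite_finite_induct) (auto intro: assms)
  from this[of "Poly_Mapping.keys F"] show ?thesis by (simp add: sum_singles)
qed

lemma const_0 [simp]: "const 0 = 0" and const_1 [simp]: "const 1 = 1"
  by (simp_all add: const_def)

lemma const_add: "const (a + b) = const a + const b"
  by (simp add: const_def single_add)

lemma const_mult: "const (a * b) = const a * const b"
  by (simp add: const_def mult_single)

lemma const_power: "const (a ^ n) = const a ^ n" for a :: "'a::comm_semiring_1"
  by (induction n) (simp_all add: const_mult)

lemma const_prod: "const (prod f A) = (\<Prod>i\<in>A. const (f i))" for f :: "'b \<Rightarrow> 'a::comm_semiring_1"
  by (induction A rule: infinite_finite_induct) (simp_all add: const_mult)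

lemma const_eq_0_iff [simp]: "const a = 0 \<longleftrightarrow> a = 0"
  using inj_single[of "0::4 \<Rightarrow>\<^sub>0 nat"] unfolding const_def inj_def by (metis single_zero)

text \<open>Cancellation can make the support of \<open>F + G\<close> smaller than the union of the
  two supports. Over a common finite superset the sums for \<open>F\<close>, \<open>G\<close> and
  \<open>F + G\<close> become comparable.\<close>

lemma subst_superset:
  assumes "finite A" "Poly_Mapping.keys F \<subseteq> A"
  shows "subst Y F = (\<Sum>\<alpha>\<in>A.
     const (Poly_Mapping.lookup F \<alpha>) * (\<Prod>i\<in>UNIV. Y i ^ Poly_Mapping.lookup \<alpha> i))"
  unfolding subst_def using assms
  by (intro sum.mono_neutral_left) (auto simp: in_keys_iff)

lemma subst_0 [simp]: "subst Y 0 = 0"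
  by (simp add: subst_def)

lemma subst_add: "subst Y (F + G) = subst Y F + subst Y G"
proof -
  let ?A = "Poly_Mapping.keys F \<union> Poly_Mapping.keys G"
  have "finite ?A" "Poly_Mapping.keys (F + G) \<subseteq> ?A"
    using keys_add[of F G] by auto
  then show ?thesis
    by (simp add: subst_superset[of ?A] lookup_add const_add sum.distrib distrib_right)
qed

lemma subst_single:
  "subst Y (Poly_Mapping.single \<alpha> c) = const c * (\<Prod>i\<in>UNIV. Y i ^ Poly_Mapping.lookup \<alpha> i)"
  by (simp add: subst_def)

lemma subst_mult: "subst Y (F * G) = subst Y F * subst Y G"
proof (induction F rule: additive_induct)
  case (single \<alpha> c)
  show ?case
    by (induction G rule: additive_induct)
       (simp_all add: subst_add distrib_left distrib_right mult_single subst_single const_mult lookup_add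
          power_add prod.distrib mult_ac)
qed (simp_all add: subst_add distrib_right)

lemma subst_const [simp]: "subst Y (const c) = const c"
  unfolding const_def[of c] subst_single by simp

lemma subst_1 [simp]: "subst Y 1 = 1"
  using subst_const[of Y 1] by simp

lemma subst_X [simp]: "subst Y (X i) = Y i"
proof -
  have "(\<Prod>j\<in>UNIV. Y j ^ Poly_Mapping.lookup (Poly_Mapping.single i 1) j) =
      (\<Prod>j\<in>UNIV. if i = j then Y j else 1)"
    by (rule prod.cong) (auto simp: lookup_single)
  then show ?thesis by (simp add: X_def subst_single)
qed

lemma subst_diff: "subst Y (F - G) = subst Y F - subst Y G"
  using subst_add[of Y "F - G" G] by simp

lemma subst_power: "subst Y (F ^ n) = subst Y F ^ n"
  by (induction n) (simp_all add: subst_mult)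

lemma subst_prod: "subst Y (prod F A) = (\<Prod>i\<in>A. subst Y (F i))"
  by (induction A rule: infinite_finite_induct) (simp_all add: subst_mult)

lemma subst_subst: "subst Y (subst Z F) = subst (\<lambda>i. subst Y (Z i)) F"
  by (induction F rule: additive_induct)
     (simp_all add: subst_add subst_single subst_mult subst_prod subst_power)

lemma X_power: "X i ^ n = Poly_Mapping.single (Poly_Mapping.single i n) (1::'a::comm_semiring_1)"
  by (induction n) (simp_all add: X_def mult_single flip: Poly_Mapping.single_add)

lemma prod_single_1:
  "(\<Prod>i\<in>A. Poly_Mapping.single (f i) (1::'a::comm_semiring_1)) = Poly_Mapping.single (\<Sum>i\<in>A. f i) 1"
  for f :: "'b \<Rightarrow> 'c::comm_monoid_add"
  by (induction A rule: infinite_finite_induct) (simp_all add: mult_single)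

lemma sum_single_lookup: "(\<Sum>i\<in>UNIV. Poly_Mapping.single i (Poly_Mapping.lookup \<alpha> i)) = \<alpha>"
  for \<alpha> :: "'b::finite \<Rightarrow>\<^sub>0 'c::comm_monoid_add"
  by (rule poly_mapping_eqI) (simp add: lookup_sum lookup_single when_def sum.delta)

lemma prod_X_power:
  "(\<Prod>i\<in>UNIV. X i ^ Poly_Mapping.lookup \<alpha> i) = Poly_Mapping.single \<alpha> (1::'a::comm_semiring_1)"
  by (simp add: X_power prod_single_1 sum_single_lookup)

lemma const_times_single: "const c * Poly_Mapping.single \<alpha> a = Poly_Mapping.single \<alpha> (c * a)"
  by (simp add: const_def mult_single)

lemma subst_X_id [simp]: "subst X F = F"
  by (simp add: subst_def prod_X_power const_times_single sum_singles)

section \<open>Homogeneous forms under substitution\<close>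

lemma homogeneous_subst_scale:
  assumes "homogeneous d F"
  shows "subst (\<lambda>i. A * Y i) F = A ^ d * subst Y F"
  unfolding subst_def sum_distrib_left
proof (rule sum.cong)
  fix \<alpha> assume "\<alpha> \<in> Poly_Mapping.keys F"
  then have "mdeg \<alpha> = d" using assms by (simp add: homogeneous_def)
  then show "const (Poly_Mapping.lookup F \<alpha>) * (\<Prod>i\<in>UNIV. (A * Y i) ^ Poly_Mapping.lookup \<alpha> i) =
     A ^ d * (const (Poly_Mapping.lookup F \<alpha>) * (\<Prod>i\<in>UNIV. Y i ^ Poly_Mapping.lookup \<alpha> i))"
    by (simp add: power_mult_distrib prod.distrib flip: power_sum)
qed simp

lemma homogeneous_0 [simp]: "homogeneous d 0"
  by (simp add: homogeneous_def)

lemma homogeneous_add: "homogeneous d F \<Longrightarrow> homogeneous d G \<Longrightarrow> homogeneous d (F + G)"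
  using keys_add[of F G] unfolding homogeneous_def by blast

lemma homogeneous_sum: "(\<And>i. i \<in> A \<Longrightarrow> homogeneous d (F i)) \<Longrightarrow> homogeneous d (sum F A)"
  by (induction A rule: infinite_finite_induct) (auto intro: homogeneous_add)

lemma homogeneous_mult:
  assumes "homogeneous d F" "homogeneous e G" shows "homogeneous (d + e) (F * G)"
  unfolding homogeneous_def
proof
  fix \<gamma> assume "\<gamma> \<in> Poly_Mapping.keys (F * G)"
  then obtain \<alpha> \<beta> where "\<gamma> = \<alpha> + \<beta>" "\<alpha> \<in> Poly_Mapping.keys F" "\<beta> \<in> Poly_Mapping.keys G"
    using keys_mult[of F G] by blast
  then show "mdeg \<gamma> = d + e" using assms by (simp add: homogeneous_def mdeg_add)
qed

lemma homogeneous_const [simp]: "homogeneous 0 (const c)"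
  by (simp add: homogeneous_def const_def)

lemma homogeneous_1 [simp]: "homogeneous 0 1"
  by (simp add: homogeneous_def)

lemma homogeneous_X [simp]: "homogeneous (Suc 0) (X i)"
  by (simp add: homogeneous_def X_def)

lemma homogeneous_power: "homogeneous d F \<Longrightarrow> homogeneous (n * d) (F ^ n)"
  by (induction n) (auto intro: homogeneous_mult)

lemma homogeneous_prod:
  "(\<And>i. i \<in> A \<Longrightarrow> homogeneous (d i) (F i)) \<Longrightarrow> homogeneous (sum d A) (prod F A)"
  by (induction A rule: infinite_finite_induct) (auto intro: homogeneous_mult)

lemma homogeneous_subst:
  assumes "homogeneous d F" "\<And>i. homogeneous e (Y i)"
  shows "homogeneous (d * e) (subst Y F)"
  unfolding subst_def
proof (rule homogeneous_sum)
  fix \<alpha> assume "\<alpha> \<in> Poly_Mapping.keys F"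
  then have "mdeg \<alpha> = d" using assms by (simp add: homogeneous_def)
  then have "homogeneous (d * e) (\<Prod>i\<in>UNIV. Y i ^ Poly_Mapping.lookup \<alpha> i)"
    using homogeneous_prod[of UNIV "\<lambda>i. Poly_Mapping.lookup \<alpha> i * e" "\<lambda>i. Y i ^ Poly_Mapping.lookup \<alpha> i"]
    by (simp add: homogeneous_power assms(2) flip: sum_distrib_right)
  then show "homogeneous (d * e) (const (Poly_Mapping.lookup F \<alpha>) * (\<Prod>i\<in>UNIV. Y i ^ Poly_Mapping.lookup \<alpha> i))"
    using homogeneous_mult[OF homogeneous_const] by fastforce
qed

section \<open>The order of vanishing at a point\<close>

text \<open>Membership in the \<open>n\<close>-th power of the maximal ideal at the origin. Unlike
  the minimum in \<open>mult_at\<close>, it is meaningful for the zero polynomial, which has every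
  order, and is therefore closed under sums.\<close>

definition order_ge :: "nat \<Rightarrow> 'a::zero quaternary \<Rightarrow> bool" where
  "order_ge n F \<longleftrightarrow> (\<forall>\<alpha>\<in>Poly_Mapping.keys F. n \<le> mdeg \<alpha>)"

lemma order_geD: "order_ge n F \<Longrightarrow> mdeg \<alpha> < n \<Longrightarrow> Poly_Mapping.lookup F \<alpha> = 0"
  unfolding order_ge_def by (metis in_keys_iff not_less)

lemma order_ge_0 [simp]: "order_ge 0 F" and order_ge_zero [simp]: "order_ge n 0"
  by (simp_all add: order_ge_def)

lemma order_ge_add: "order_ge n F \<Longrightarrow> order_ge n G \<Longrightarrow> order_ge n (F + G)"
  using keys_add[of F G] unfolding order_ge_def by blast

lemma order_ge_sum: "(\<And>i. i \<in> A \<Longrightarrow> order_ge n (F i)) \<Longrightarrow> order_ge n (sum F A)"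
  by (induction A rule: infinite_finite_induct) (auto intro: order_ge_add)

lemma order_ge_mult:
  assumes "order_ge m F" "order_ge n G" shows "order_ge (m + n) (F * G)"
  unfolding order_ge_def
proof
  fix \<gamma> assume "\<gamma> \<in> Poly_Mapping.keys (F * G)"
  then obtain \<alpha> \<beta> where "\<gamma> = \<alpha> + \<beta>" "\<alpha> \<in> Poly_Mapping.keys F" "\<beta> \<in> Poly_Mapping.keys G"
    using keys_mult[of F G] by blast
  then show "m + n \<le> mdeg \<gamma>" using assms by (simp add: order_ge_def mdeg_add add_mono)
qed

lemma order_ge_prod:
  "(\<And>i. i \<in> A \<Longrightarrow> order_ge (n i) (F i)) \<Longrightarrow> order_ge (sum n A) (prod F A)"
  for F :: "'b \<Rightarrow> 'a::comm_semiring_1 quaternary"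
  by (induction A rule: infinite_finite_induct) (auto intro: order_ge_mult)

lemma order_ge_power: "order_ge n F \<Longrightarrow> order_ge (k * n) (F ^ k)"
  for F :: "'a::comm_semiring_1 quaternary"
  by (induction k) (auto intro: order_ge_mult)

lemma order_ge_mono: "order_ge n F \<Longrightarrow> m \<le> n \<Longrightarrow> order_ge m F"
  by (auto simp: order_ge_def intro: order_trans)

text \<open>Each \<open>Z i\<close> vanishes at the origin, so a monomial becomes a product of as
  many factors without constant term as its degree.\<close>

lemma order_ge_subst:
  assumes "order_ge n F" "\<And>i. order_ge 1 (Z i)" shows "order_ge n (subst Z F)"
  unfolding subst_def
proof (rule order_ge_sum)
  fix \<alpha> assume "\<alpha> \<in> Poly_Mapping.keys F"
  then have n: "n \<le> mdeg \<alpha>" using assms by (simp add: order_ge_def)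
  have "order_ge (mdeg \<alpha>) (\<Prod>i\<in>UNIV. Z i ^ Poly_Mapping.lookup \<alpha> i)"
    by (rule order_ge_prod) (use order_ge_power[OF assms(2)] in force)
  then have "order_ge (0 + mdeg \<alpha>) (const (Poly_Mapping.lookup F \<alpha>) * (\<Prod>i\<in>UNIV. Z i ^ Poly_Mapping.lookup \<alpha> i))"
    by (intro order_ge_mult) simp_all
  then show "order_ge n (const (Poly_Mapping.lookup F \<alpha>) * (\<Prod>i\<in>UNIV. Z i ^ Poly_Mapping.lookup \<alpha> i))"
    using n by (auto intro: order_ge_mono)
qed

lemma order_ge_bounded:
  assumes "F \<noteq> 0" obtains b where "\<And>n. order_ge n F \<Longrightarrow> n \<le> b"
proof -
  obtain \<alpha> where "\<alpha> \<in> Poly_Mapping.keys F"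
    using assms by (metis all_not_in_conv keys_eq_empty)
  then show thesis by (intro that[of "mdeg \<alpha>"]) (auto simp: order_ge_def)
qed

section \<open>Initial forms and the order of a product\<close>

definition leading :: "nat \<Rightarrow> 'a::comm_ring_1 quaternary \<Rightarrow> 'a quaternary" where
  "leading n F = (\<Sum>\<alpha> | \<alpha> \<in> Poly_Mapping.keys F \<and> mdeg \<alpha> = n.
     Poly_Mapping.single \<alpha> (Poly_Mapping.lookup F \<alpha>))"

lemma lookup_leading:
  "Poly_Mapping.lookup (leading n F) \<alpha> = (if mdeg \<alpha> = n then Poly_Mapping.lookup F \<alpha> else 0)"
proof -
  have "Poly_Mapping.lookup (leading n F) \<alpha> =
     (\<Sum>\<beta> | \<beta> \<in> Poly_Mapping.keys F \<and> mdeg \<beta> = n. if \<beta> = \<alpha> then Poly_Mapping.lookup F \<beta> else 0)"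
    unfolding leading_def lookup_sum by (rule sum.cong) (auto simp: lookup_single when_def)
  also have "\<dots> = (if mdeg \<alpha> = n then Poly_Mapping.lookup F \<alpha> else 0)"
    by (subst sum.delta) (auto simp: in_keys_iff)
  finally show ?thesis .
qed

lemma homogeneous_leading: "homogeneous n (leading n F)"
  by (auto simp: homogeneous_def in_keys_iff lookup_leading split: if_splits)

lemma order_ge_minus_leading:
  assumes "order_ge n F" shows "order_ge (Suc n) (F - leading n F)"
  unfolding order_ge_def
proof
  fix \<alpha> assume "\<alpha> \<in> Poly_Mapping.keys (F - leading n F)"
  then have "mdeg \<alpha> \<noteq> n" "\<alpha> \<in> Poly_Mapping.keys F"
    by (auto simp: in_keys_iff lookup_minus lookup_leading split: if_splits)
  then show "Suc n \<le> mdeg \<alpha>" using assms by (fastforce simp: order_ge_def)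
qed

text \<open>The lowest forms of \<open>F\<close> and \<open>G\<close> have a nonzero product because
  polynomials over a field form a domain. This product is the part of \<open>F * G\<close> in degree
  \<open>m + n\<close>, so orders add exactly.\<close>

lemma order_ge_mult_iff:
  fixes F G :: "'a::field quaternary"
  assumes F: "order_ge m F" "\<not> order_ge (Suc m) F" and G: "order_ge n G" "\<not> order_ge (Suc n) G"
  shows "order_ge (m + n) (F * G)" "\<not> order_ge (Suc (m + n)) (F * G)"
proof -
  show "order_ge (m + n) (F * G)" by (rule order_ge_mult[OF F(1) G(1)])
  define F0 G0 where "F0 = leading m F" and "G0 = leading n G"
  have "F0 \<noteq> 0" "G0 \<noteq> 0"
    using order_ge_minus_leading F G unfolding F0_def G0_def by (metis diff_zero)+
  then have "F0 * G0 \<noteq> 0" by simp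
  then obtain \<gamma> where \<gamma>: "\<gamma> \<in> Poly_Mapping.keys (F0 * G0)"
    by (metis all_not_in_conv keys_eq_empty)
  then have deg: "mdeg \<gamma> = m + n"
    using homogeneous_mult[OF homogeneous_leading[of m F] homogeneous_leading[of n G]]
    by (simp add: homogeneous_def F0_def G0_def)
  \<comment> \<open>All terms other than \<open>F0 * G0\<close> have order above
    \<open>m + n\<close>, the degree of \<open>\<gamma>\<close>, and do not contribute to the
    coefficient there.\<close>
  have "F * G = F0 * G0 + ((F - F0) * G + F0 * (G - G0))"
    by (simp add: algebra_simps)
  moreover have "order_ge (Suc (m + n)) ((F - F0) * G + F0 * (G - G0))"
  proof (rule order_ge_add)
    show "order_ge (Suc (m + n)) ((F - F0) * G)"
      using order_ge_mult[OF order_ge_minus_leading[OF F(1)] G(1)] by (simp add: F0_def)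
    have "order_ge m F0"
      using homogeneous_leading[of m F] by (simp add: order_ge_def homogeneous_def F0_def)
    then show "order_ge (Suc (m + n)) (F0 * (G - G0))"
      using order_ge_mult[OF _ order_ge_minus_leading[OF G(1)]] by (fastforce simp: G0_def)
  qed
  then have "Poly_Mapping.lookup ((F - F0) * G + F0 * (G - G0)) \<gamma> = 0"
    using deg by (intro order_geD) auto
  ultimately have "Poly_Mapping.lookup (F * G) \<gamma> = Poly_Mapping.lookup (F0 * G0) \<gamma>"
    by (metis add.right_neutral lookup_add)
  then show "\<not> order_ge (Suc (m + n)) (F * G)"
    using \<gamma> deg order_geD[of "Suc (m + n)" "F * G" \<gamma>] by (auto simp: in_keys_iff)
qed

lemma order_ge_1_iff: "order_ge 1 F \<longleftrightarrow> Poly_Mapping.lookup F 0 = 0"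
proof
  assume "order_ge 1 F" then show "Poly_Mapping.lookup F 0 = 0"
    by (force simp: order_ge_def in_keys_iff)
next
  assume *: "Poly_Mapping.lookup F 0 = 0"
  show "order_ge 1 F" unfolding order_ge_def
  proof
    fix \<alpha> assume "\<alpha> \<in> Poly_Mapping.keys F"
    then have "\<alpha> \<noteq> 0" using * by (auto simp: in_keys_iff)
    then obtain i where "Poly_Mapping.lookup \<alpha> i \<noteq> 0"
      by (metis lookup_zero poly_mapping_eqI)
    then have "0 < mdeg \<alpha>" by (subst sum_pos2[of UNIV i]) auto
    then show "1 \<le> mdeg \<alpha>" by simp
  qed
qed

abbreviation translate :: "'a::field ^ 4 \<Rightarrow> 'a quaternary \<Rightarrow> 'a quaternary" where
  "translate x \<equiv> subst (\<lambda>i. X i + const (x $ i))"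

text \<open>Invertibility of the translation keeps nonzero polynomials nonzero, so that the minimum
  in \<open>mult_at\<close> is taken over a nonempty set.\<close>

lemma translate_neg: "translate x (translate (- x) F) = F"
proof -
  have "const (x $ i) + const (- (x $ i)) = 0" for i
    by (simp flip: const_add)
  then have "(\<lambda>i. translate x (X i + const ((- x) $ i))) = X"
    by (simp add: subst_add add.assoc)
  then show ?thesis by (simp add: subst_subst)
qed

lemma translate_eq_0_iff [simp]: "translate x F = 0 \<longleftrightarrow> F = 0"
  using translate_neg[of "- x" F] by force

lemma le_mult_at_iff:
  assumes "F \<noteq> 0" shows "n \<le> mult_at x F \<longleftrightarrow> order_ge n (translate x F)"
proof -
  have "Poly_Mapping.keys (translate x F) \<noteq> {}" using assms by simp
  then show ?thesis unfolding mult_at_def order_ge_def by simp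
qed

lemma mult_at_eqI:
  assumes "order_ge n (translate x F)" "\<not> order_ge (Suc n) (translate x F)"
  shows "mult_at x F = n"
proof -
  have "F \<noteq> 0" using assms(2) by auto
  then show ?thesis using assms le_mult_at_iff[of F _ x] by (metis le_antisym not_less_eq_eq)
qed

lemma mult_at_mult:
  assumes "F \<noteq> 0" "G \<noteq> 0" shows "mult_at x (F * G) = mult_at x F + mult_at x G"
proof -
  have *: "order_ge (mult_at x H) (translate x H)" "\<not> order_ge (Suc (mult_at x H)) (translate x H)"
    if "H \<noteq> 0" for H :: "'a quaternary"
    using le_mult_at_iff[OF that, of _ x] by (blast, metis Suc_n_not_le_n)
  show ?thesis
    by (rule mult_at_eqI; subst subst_mult; intro order_ge_mult_iff * assms)
qed

text \<open>The hypothesis on \<open>y\<close> says that the polynomial map \<open>Y\<close> takes \<open>x\<close> to \<open>y\<close>.\<close>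

lemma mult_at_subst_ge:
  assumes "subst Y F \<noteq> 0" and y: "\<And>i. order_ge 1 (translate x (Y i) - const (y $ i))"
  shows "mult_at y F \<le> mult_at x (subst Y F)"
proof -
  have F: "F \<noteq> 0" using assms(1) by auto
  let ?Z = "\<lambda>i. translate x (Y i) - const (y $ i)"
  have "translate x (subst Y F) = subst ?Z (translate y F)"
    by (simp add: subst_subst subst_add)
  \<comment> \<open>The Taylor expansion of \<open>subst Y F\<close> at \<open>x\<close> arises from
    that of \<open>F\<close> at \<open>y\<close> by inserting the increments \<open>?Z\<close>,
    which vanish at the origin.\<close>
  moreover have "order_ge (mult_at y F) (subst ?Z (translate y F))"
    using le_mult_at_iff[OF F, of "mult_at y F" y] y
    by (intro order_ge_subst[of _ "translate y F"]) auto
  ultimately show ?thesis by (simp add: le_mult_at_iff[OF assms(1)])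
qed

section \<open>Monomials and coordinate planes\<close>

lemma subst_zero: "subst (\<lambda>_. 0) F = const (Poly_Mapping.lookup F 0)"
proof (induction F rule: additive_induct)
  case (single \<alpha> c)
  have "(\<Prod>i\<in>UNIV. (0::'a quaternary) ^ Poly_Mapping.lookup \<alpha> i) = (if \<alpha> = 0 then 1 else 0)"
  proof (cases "\<alpha> = 0")
    case False
    then obtain i where "Poly_Mapping.lookup \<alpha> i \<noteq> 0"
      by (metis lookup_zero poly_mapping_eqI)
    then have "(\<Prod>i\<in>UNIV. (0::'a quaternary) ^ Poly_Mapping.lookup \<alpha> i) = 0"
      by (intro prod_zero) (auto intro!: bexI[of _ i])
    then show ?thesis using False by simp
  qed simp
  then show ?case by (simp add: subst_single lookup_single when_def)
qed (simp_all add: subst_add lookup_add const_add)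

abbreviation eval_at :: "'a::field ^ 4 \<Rightarrow> 'a quaternary \<Rightarrow> 'a quaternary" where
  "eval_at x \<equiv> subst (\<lambda>i. const (x $ i))"

lemma order_ge_1_translate_iff: "order_ge 1 (translate x F - const c) \<longleftrightarrow> eval_at x F = const c"
proof -
  have "order_ge 1 (translate x F - const c) \<longleftrightarrow> subst (\<lambda>_. 0) (translate x F - const c) = 0"
    by (simp add: order_ge_1_iff subst_zero del: One_nat_def)
  then show ?thesis by (simp add: subst_diff subst_subst subst_add)
qed

lemma mult_at_eq_0_iff: "F \<noteq> 0 \<Longrightarrow> mult_at x F = 0 \<longleftrightarrow> eval_at x F \<noteq> 0"
  using le_mult_at_iff[of F 1 x] order_ge_1_translate_iff[of x F 0] by auto

lemma single_1_dvd_iff: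
  "Poly_Mapping.single \<gamma> 1 dvd F \<longleftrightarrow> (\<forall>\<alpha>\<in>Poly_Mapping.keys F. \<exists>\<beta>. \<alpha> = \<gamma> + \<beta>)"
  for F :: "'a::field quaternary"
proof
  assume "Poly_Mapping.single \<gamma> 1 dvd F"
  then obtain G where "F = Poly_Mapping.single \<gamma> 1 * G" by (auto elim: dvdE)
  then show "\<forall>\<alpha>\<in>Poly_Mapping.keys F. \<exists>\<beta>. \<alpha> = \<gamma> + \<beta>"
    using keys_mult[of "Poly_Mapping.single \<gamma> 1" G] by auto
next
  assume *: "\<forall>\<alpha>\<in>Poly_Mapping.keys F. \<exists>\<beta>. \<alpha> = \<gamma> + \<beta>"
  have "Poly_Mapping.single \<gamma> 1 dvd
     (\<Sum>\<alpha>\<in>Poly_Mapping.keys F. Poly_Mapping.single \<alpha> (Poly_Mapping.lookup F \<alpha>))"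
  proof (rule dvd_sum)
    fix \<alpha> assume "\<alpha> \<in> Poly_Mapping.keys F"
    then obtain \<beta> where "\<alpha> = \<gamma> + \<beta>" using * by blast
    then show "Poly_Mapping.single \<gamma> 1 dvd Poly_Mapping.single \<alpha> (Poly_Mapping.lookup F \<alpha>)"
      by (intro dvdI[of _ _ "Poly_Mapping.single \<beta> (Poly_Mapping.lookup F \<alpha>)"]) (simp add: mult_single)
  qed
  then show "Poly_Mapping.single \<gamma> 1 dvd F" by (simp add: sum_singles)
qed

lemma X_power_dvd_iff:
  "X i ^ n dvd F \<longleftrightarrow> (\<forall>\<alpha>\<in>Poly_Mapping.keys F. n \<le> Poly_Mapping.lookup \<alpha> i)"
  for F :: "'a::field quaternary"
proof -
  have "(\<exists>\<beta>. \<alpha> = Poly_Mapping.single i n + \<beta>) \<longleftrightarrow> n \<le> Poly_Mapping.lookup \<alpha> i" for \<alpha>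
  proof
    assume "n \<le> Poly_Mapping.lookup \<alpha> i"
    then have "\<alpha> = Poly_Mapping.single i n + (\<alpha> - Poly_Mapping.single i n)"
      by (intro poly_mapping_eqI) (auto simp: lookup_add lookup_minus lookup_single when_def)
    then show "\<exists>\<beta>. \<alpha> = Poly_Mapping.single i n + \<beta>" by blast
  qed (auto simp: lookup_add)
  then show ?thesis by (simp add: X_power single_1_dvd_iff)
qed

lemma X_dvd_iff: "X i dvd F \<longleftrightarrow> (\<forall>\<alpha>\<in>Poly_Mapping.keys F. Poly_Mapping.lookup \<alpha> i \<noteq> 0)"
  for F :: "'a::field quaternary"
  using X_power_dvd_iff[of i 1 F] by (simp add: Suc_le_eq)

lemma lookup_subst_kill:
  "Poly_Mapping.lookup (subst (\<lambda>j. if j = i then 0 else X j) F) \<alpha> =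
     (if Poly_Mapping.lookup \<alpha> i = 0 then Poly_Mapping.lookup F \<alpha> else 0)"
proof (induction F rule: additive_induct)
  case (single \<beta> c)
  let ?P = "\<Prod>j\<in>UNIV. (if j = i then 0 else X j) ^ Poly_Mapping.lookup \<beta> j :: 'a quaternary"
  have "?P = (if Poly_Mapping.lookup \<beta> i = 0 then Poly_Mapping.single \<beta> 1 else 0)"
  proof (cases "Poly_Mapping.lookup \<beta> i = 0")
    case True
    then have "?P = (\<Prod>j\<in>UNIV. X j ^ Poly_Mapping.lookup \<beta> j)"
      by (intro prod.cong) auto
    then show ?thesis using True by (simp add: prod_X_power)
  next
    case False
    then have "?P = 0" by (intro prod_zero) (auto intro!: bexI[of _ i])
    then show ?thesis using False by simp
  qed
  then show ?case
    by (auto simp: subst_single const_times_single lookup_single when_def)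
qed (simp_all add: subst_add lookup_add)

lemma X_neq_0 [simp]: "X i \<noteq> (0 :: 'a::field quaternary)"
  by (metis X_def keys_single keys_zero insert_not_empty zero_neq_one)

text \<open>Exactly the monomials free of \<open>X i\<close> survive when \<open>X i\<close> is set
  to zero. Divisibility by \<open>X i\<close> is thus membership in the kernel of a ring
  homomorphism into a domain.\<close>

lemma prime_elem_X: "prime_elem (X i :: 'a::field quaternary)"
proof (rule prime_elemI)
  show "\<not> X i dvd (1 :: 'a quaternary)" by (simp add: X_dvd_iff)
  have *: "X i dvd F \<longleftrightarrow> subst (\<lambda>j. if j = i then 0 else X j) F = 0" for F :: "'a quaternary"
    unfolding X_dvd_iff poly_mapping_eq_iff fun_eq_iff lookup_subst_kill
    by (metis in_keys_iff lookup_zero)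
  fix F G :: "'a quaternary" assume "X i dvd F * G"
  then show "X i dvd F \<or> X i dvd G" by (simp add: * subst_mult)
qed simp

lemma dvd_prime_mult_cancel:
  fixes p T A :: "'b::idom"
  assumes "prime_elem p" "\<not> p dvd T" "T dvd p * A" shows "T dvd A"
proof -
  obtain Q where Q: "p * A = T * Q" using assms(3) by (auto elim: dvdE)
  then have "p dvd T * Q" by (metis dvd_triv_left)
  then obtain R where "Q = p * R"
    using assms(1,2) by (auto simp: prime_elem_dvd_mult_iff elim: dvdE)
  then have "p * A = p * (T * R)" using Q by (simp add: mult_ac)
  then show ?thesis using assms(1) by auto
qed

text \<open>Reflections of one polynomial with different bounds differ by monomial factors, which
  this lemma removes from divisibility statements. The variables are primes not dividing
  \<open>T\<close>, so they cancel one at a time.\<close>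

lemma dvd_single_mult_cancel:
  fixes T A :: "'a::field quaternary"
  assumes T: "\<And>i. \<not> X i dvd T" and "T dvd Poly_Mapping.single \<gamma> 1 * A"
  shows "T dvd A"
proof -
  have pow: "T dvd A" if "T dvd X i ^ n * A" for i n A
    using that
  proof (induction n)
    case (Suc n)
    then have "T dvd X i * (X i ^ n * A)" by (simp add: mult.assoc)
    from dvd_prime_mult_cancel[OF prime_elem_X T this] show ?case by (rule Suc.IH)
  qed simp
  have "T dvd A" if "T dvd (\<Prod>i\<in>I. X i ^ e i) * A" for e I A
    using that
  proof (induction I arbitrary: A rule: infinite_finite_induct)
    case (insert i I)
    have "T dvd X i ^ e i * ((\<Prod>i\<in>I. X i ^ e i) * A)"
      using insert.prems insert.hyps by (simp add: mult.assoc)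
    from pow[OF this] show ?case by (rule insert.IH)
  qed simp_all
  from this[of "Poly_Mapping.lookup \<gamma>" UNIV A] show ?thesis
    using assms(2) by (simp add: prod_X_power)
qed

section \<open>Reflection of exponents\<close>

text \<open>Unlike the pull-back along \<open>Cr\<close>, reflection is also well behaved on inhomogeneous
  polynomials, which have to be considered because \<open>prime_elem\<close> refers to them.\<close>

definition bounded_by :: "(4 \<Rightarrow>\<^sub>0 nat) \<Rightarrow> 'a::zero quaternary \<Rightarrow> bool" where
  "bounded_by D F \<longleftrightarrow> (\<forall>\<alpha>\<in>Poly_Mapping.keys F. \<exists>\<beta>. D = \<alpha> + \<beta>)"

text \<open>The difference of exponents is truncated, so this is a genuine reflection only under
  \<open>bounded_by D F\<close>. The bound is stated there as \<open>D = \<alpha> + \<beta>\<close>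
  so that \<open>D - \<alpha>\<close> simplifies to \<open>\<beta>\<close>.\<close>

definition reflect :: "(4 \<Rightarrow>\<^sub>0 nat) \<Rightarrow> 'a::comm_ring_1 quaternary \<Rightarrow> 'a quaternary" where
  "reflect D F = (\<Sum>\<alpha>\<in>Poly_Mapping.keys F. Poly_Mapping.single (D - \<alpha>) (Poly_Mapping.lookup F \<alpha>))"

lemma reflect_0 [simp]: "reflect D 0 = 0"
  by (simp add: reflect_def)

lemma reflect_single [simp]:
  "reflect D (Poly_Mapping.single \<alpha> c) = Poly_Mapping.single (D - \<alpha>) c"
  by (simp add: reflect_def)

lemma reflect_add: "reflect D (F + G) = reflect D F + reflect D G"
proof -
  have *: "reflect D H = (\<Sum>\<alpha>\<in>A. Poly_Mapping.single (D - \<alpha>) (Poly_Mapping.lookup H \<alpha>))"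
    if "finite A" "Poly_Mapping.keys H \<subseteq> A" for A and H :: "'a quaternary"
    unfolding reflect_def using that by (intro sum.mono_neutral_left) (auto simp: in_keys_iff)
  let ?A = "Poly_Mapping.keys F \<union> Poly_Mapping.keys G"
  have "Poly_Mapping.keys (F + G) \<subseteq> ?A" by (rule keys_add)
  then show ?thesis
    by (simp add: *[of ?A] lookup_add single_add sum.distrib)
qed

lemma reflect_sum: "reflect D (sum f A) = (\<Sum>i\<in>A. reflect D (f i))"
  by (induction A rule: infinite_finite_induct) (simp_all add: reflect_add)

lemma reflect_reflect:
  assumes "bounded_by D F" shows "reflect D (reflect D F) = F"
proof -
  have "reflect D (reflect D F) =
      (\<Sum>\<alpha>\<in>Poly_Mapping.keys F. Poly_Mapping.single (D - (D - \<alpha>)) (Poly_Mapping.lookup F \<alpha>))"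
    by (simp add: reflect_def[of D F] reflect_sum)
  also have "\<dots> = (\<Sum>\<alpha>\<in>Poly_Mapping.keys F. Poly_Mapping.single \<alpha> (Poly_Mapping.lookup F \<alpha>))"
  proof (rule sum.cong)
    fix \<alpha> assume "\<alpha> \<in> Poly_Mapping.keys F"
    then obtain \<beta> where "D = \<alpha> + \<beta>" using assms by (auto simp: bounded_by_def)
    then have "D - (D - \<alpha>) = \<alpha>" by simp
    then show "Poly_Mapping.single (D - (D - \<alpha>)) (Poly_Mapping.lookup F \<alpha>) =
        Poly_Mapping.single \<alpha> (Poly_Mapping.lookup F \<alpha>)" by simp
  qed simp
  finally show ?thesis by (simp add: sum_singles)
qed

lemma keys_reflect_subset: "Poly_Mapping.keys (reflect D F) \<subseteq> (\<lambda>\<alpha>. D - \<alpha>) ` Poly_Mapping.keys F"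
  unfolding reflect_def by (rule order_trans[OF keys_sum]) auto

lemma bounded_by_reflect:
  assumes "bounded_by D F" shows "bounded_by D (reflect D F)"
  unfolding bounded_by_def
proof
  fix \<gamma> assume "\<gamma> \<in> Poly_Mapping.keys (reflect D F)"
  then obtain \<alpha> where \<alpha>: "\<alpha> \<in> Poly_Mapping.keys F" "\<gamma> = D - \<alpha>"
    using keys_reflect_subset by blast
  then obtain \<beta> where "D = \<alpha> + \<beta>" using assms by (auto simp: bounded_by_def)
  then have "D = \<gamma> + \<alpha>" using \<alpha> by (simp add: add.commute)
  then show "\<exists>\<beta>. D = \<gamma> + \<beta>" by blast
qed

text \<open>On exponents below \<open>D\<close> the reflection is injective, so no coefficients
  cancel. This is obtained by applying the general inclusion to \<open>reflect D F\<close> as well,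
  whose reflection is \<open>F\<close> again.\<close>

lemma keys_reflect:
  assumes "bounded_by D F"
  shows "Poly_Mapping.keys (reflect D F) = (\<lambda>\<alpha>. D - \<alpha>) ` Poly_Mapping.keys F"
proof (rule antisym[OF keys_reflect_subset subsetI])
  fix \<gamma> assume "\<gamma> \<in> (\<lambda>\<alpha>. D - \<alpha>) ` Poly_Mapping.keys F"
  then obtain \<alpha> where \<alpha>: "\<alpha> \<in> Poly_Mapping.keys F" "\<gamma> = D - \<alpha>" by blast
  then obtain \<beta> where \<beta>: "\<beta> \<in> Poly_Mapping.keys (reflect D F)" "\<alpha> = D - \<beta>"
    using keys_reflect_subset[of D "reflect D F"] reflect_reflect[OF assms] by force
  moreover obtain \<delta> where "D = \<beta> + \<delta>"
    using bounded_by_reflect[OF assms] \<beta> by (auto simp: bounded_by_def)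
  ultimately show "\<gamma> \<in> Poly_Mapping.keys (reflect D F)" using \<alpha> by simp
qed

text \<open>When nothing is truncated, \<open>(D + E) - (\<alpha> + \<beta>)\<close> equals
  \<open>(D - \<alpha>) + (E - \<beta>)\<close>.\<close>

lemma reflect_mult:
  assumes "bounded_by D F" "bounded_by E G"
  shows "reflect (D + E) (F * G) = reflect D F * reflect E G"
proof -
  have "F * G = (\<Sum>\<alpha>\<in>Poly_Mapping.keys F. \<Sum>\<beta>\<in>Poly_Mapping.keys G.
     Poly_Mapping.single (\<alpha> + \<beta>) (Poly_Mapping.lookup F \<alpha> * Poly_Mapping.lookup G \<beta>))"
    using sum_product[of "\<lambda>\<alpha>. Poly_Mapping.single \<alpha> (Poly_Mapping.lookup F \<alpha>)" "Poly_Mapping.keys F"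
        "\<lambda>\<alpha>. Poly_Mapping.single \<alpha> (Poly_Mapping.lookup G \<alpha>)" "Poly_Mapping.keys G"]
    by (simp add: sum_singles mult_single)
  then have "reflect (D + E) (F * G) = (\<Sum>\<alpha>\<in>Poly_Mapping.keys F. \<Sum>\<beta>\<in>Poly_Mapping.keys G.
     Poly_Mapping.single (D + E - (\<alpha> + \<beta>)) (Poly_Mapping.lookup F \<alpha> * Poly_Mapping.lookup G \<beta>))"
    by (simp add: reflect_sum)
  also have "\<dots> = (\<Sum>\<alpha>\<in>Poly_Mapping.keys F. \<Sum>\<beta>\<in>Poly_Mapping.keys G.
     Poly_Mapping.single (D - \<alpha>) (Poly_Mapping.lookup F \<alpha>) * Poly_Mapping.single (E - \<beta>) (Poly_Mapping.lookup G \<beta>))"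
  proof (intro sum.cong refl)
    fix \<alpha> \<beta> assume "\<alpha> \<in> Poly_Mapping.keys F" "\<beta> \<in> Poly_Mapping.keys G"
    then obtain \<gamma> \<delta> where "D = \<alpha> + \<gamma>" "E = \<beta> + \<delta>"
      using assms unfolding bounded_by_def by meson
    moreover have "\<alpha> + \<gamma> + (\<beta> + \<delta>) - (\<alpha> + \<beta>) = \<gamma> + \<delta>"
      by (simp add: diff_diff_add[symmetric] add.assoc add.left_commute[of \<gamma>])
    ultimately show "Poly_Mapping.single (D + E - (\<alpha> + \<beta>)) (Poly_Mapping.lookup F \<alpha> * Poly_Mapping.lookup G \<beta>) =
       Poly_Mapping.single (D - \<alpha>) (Poly_Mapping.lookup F \<alpha>) * Poly_Mapping.single (E - \<beta>) (Poly_Mapping.lookup G \<beta>)"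
      by (simp add: mult_single)
  qed
  also have "\<dots> = reflect D F * reflect E G"
    by (simp add: reflect_def sum_product)
  finally show ?thesis .
qed

lemma bounded_by_1 [simp]: "bounded_by D 1"
  by (simp add: bounded_by_def)

lemma reflect_1 [simp]: "reflect D 1 = Poly_Mapping.single D 1"
  using reflect_single[of D 0 1] by simp

text \<open>Reflecting the product of \<open>1\<close>, with bound \<open>E\<close>, and
  \<open>F\<close>, with bound \<open>D\<close>, turns the excess bound into a monomial
  factor.\<close>

lemma reflect_add_bound:
  "bounded_by D F \<Longrightarrow> reflect (E + D) F = Poly_Mapping.single E 1 * reflect D F"
  using reflect_mult[of E 1 D F] by simp

lemma bounded_by_mult:
  assumes "bounded_by D F" "bounded_by E G" shows "bounded_by (D + E) (F * G)"
  unfolding bounded_by_def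
proof
  fix \<gamma> assume "\<gamma> \<in> Poly_Mapping.keys (F * G)"
  then obtain \<alpha> \<beta> where \<gamma>: "\<gamma> = \<alpha> + \<beta>" "\<alpha> \<in> Poly_Mapping.keys F" "\<beta> \<in> Poly_Mapping.keys G"
    using keys_mult[of F G] by blast
  then obtain \<delta> \<epsilon> where "D = \<alpha> + \<delta>" "E = \<beta> + \<epsilon>"
    using assms unfolding bounded_by_def by meson
  then have "D + E = \<gamma> + (\<delta> + \<epsilon>)" by (simp add: \<gamma> add_ac)
  then show "\<exists>\<beta>. D + E = \<gamma> + \<beta>" by blast
qed

lemma reflect_power:
  assumes "bounded_by D F"
  obtains E where "bounded_by E (F ^ n)" "reflect E (F ^ n) = reflect D F ^ n"
proof -
  have "\<exists>E. bounded_by E (F ^ n) \<and> reflect E (F ^ n) = reflect D F ^ n"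
  proof (induction n)
    case 0
    have "bounded_by 0 (F ^ 0) \<and> reflect 0 (F ^ 0) = reflect D F ^ 0" by simp
    then show ?case by blast
  next
    case (Suc n)
    then obtain E where "bounded_by E (F ^ n)" "reflect E (F ^ n) = reflect D F ^ n" by blast
    then have "bounded_by (D + E) (F ^ Suc n) \<and> reflect (D + E) (F ^ Suc n) = reflect D F ^ Suc n"
      using assms by (simp add: bounded_by_mult reflect_mult)
    then show ?case by blast
  qed
  then show thesis using that by blast
qed

lemma exists_bounded_by: "\<exists>D. bounded_by D F"
proof -
  \<comment> \<open>The sum of all exponents in the support serves as a crude common bound.\<close>
  have "\<exists>\<beta>. \<Sum>(Poly_Mapping.keys F) = \<alpha> + \<beta>" if "\<alpha> \<in> Poly_Mapping.keys F" for \<alpha>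
    using that sum.remove[of "Poly_Mapping.keys F" \<alpha> "\<lambda>x. x"] by auto
  then show ?thesis unfolding bounded_by_def by blast
qed

text \<open>Since no variable divides \<open>T\<close>, each entry of \<open>D\<close> is the exact
  degree of \<open>S\<close> in that variable; since none divides \<open>S\<close>, the same
  \<open>D\<close> is exact for \<open>T\<close>. With both conditions the relation is
  symmetric.\<close>

definition reflects :: "(4 \<Rightarrow>\<^sub>0 nat) \<Rightarrow> 'a::field quaternary \<Rightarrow> 'a quaternary \<Rightarrow> bool" where
  "reflects D S T \<longleftrightarrow> bounded_by D S \<and> T = reflect D S \<and> (\<forall>i. \<not> X i dvd S) \<and> (\<forall>i. \<not> X i dvd T)"

lemma reflects_sym: "reflects D S T \<Longrightarrow> reflects D T S"
  by (auto simp: reflects_def bounded_by_reflect reflect_reflect)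

text \<open>Reflecting \<open>A = T ^ n * Q\<close> factor by factor yields a multiple of
  \<open>S ^ n\<close>, but with the bound of the factors in place of \<open>E\<close>. The
  discrepancy is monomial and cancels because no variable divides \<open>S\<close>.\<close>

lemma power_dvd_reflect:
  assumes "reflects D S T" "bounded_by E A" "T ^ n dvd A"
  shows "S ^ n dvd reflect E A"
proof -
  obtain Q where A: "A = T ^ n * Q" using assms(3) by (auto elim: dvdE)
  obtain E' where E': "bounded_by E' Q" using exists_bounded_by by blast
  have T: "bounded_by D T" "reflect D T = S" "\<And>i. \<not> X i dvd S"
    using reflects_sym[OF assms(1)] by (auto simp: reflects_def)
  obtain D' where D': "bounded_by D' (T ^ n)" "reflect D' (T ^ n) = S ^ n"
    using reflect_power[OF T(1), of n] T(2) by metis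
  have b: "bounded_by (D' + E') A" unfolding A by (rule bounded_by_mult[OF D'(1) E'])
  \<comment> \<open>The reflection of \<open>A\<close> with the sum of the two bounds can be
    computed from either of them.\<close>
  have "Poly_Mapping.single (D' + E') 1 * reflect E A = reflect (D' + E' + E) A"
    using reflect_add_bound[OF assms(2)] by simp
  also have "\<dots> = Poly_Mapping.single E 1 * reflect (D' + E') A"
    using reflect_add_bound[OF b, of E] by (simp add: add.commute)
  also have "reflect (D' + E') A = S ^ n * reflect E' Q"
    unfolding A by (simp add: reflect_mult[OF D'(1) E'] D'(2))
  finally have "S ^ n dvd Poly_Mapping.single (D' + E') 1 * reflect E A"
    by simp
  moreover have "\<not> X i dvd S ^ n" for i
    using T(3) prime_elem_X prime_elem_dvd_power by blast
  ultimately show ?thesis by (rule dvd_single_mult_cancel[rotated])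
qed

lemma power_dvd_reflect_iff:
  assumes "reflects D S T" "bounded_by E A" shows "S ^ n dvd reflect E A \<longleftrightarrow> T ^ n dvd A"
  using power_dvd_reflect[OF assms] power_dvd_reflect[OF reflects_sym[OF assms(1)] bounded_by_reflect[OF assms(2)]]
  by (auto simp: reflect_reflect assms(2))

lemma ord_along_reflect:
  assumes "reflects D S T" "bounded_by E A" shows "ord_along S (reflect E A) = ord_along T A"
  by (simp add: ord_along_def power_dvd_reflect_iff[OF assms])

text \<open>Every polynomial has some bound, so both factors in the definition of a prime element
  can be reflected, and divisibility by \<open>T\<close> becomes divisibility by
  \<open>S\<close>.\<close>

lemma prime_elem_reflects:
  assumes "reflects D S T" "prime_elem S" shows "prime_elem T"
proof (rule prime_elemI)
  have dvd: "S dvd reflect E A \<longleftrightarrow> T dvd A" if "bounded_by E A" for E A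
    using power_dvd_reflect_iff[OF assms(1) that, of 1] by simp
  show "T \<noteq> 0" using assms(1) by (auto simp: reflects_def)
  show "\<not> T dvd 1" using dvd[of 0 1] prime_elem_not_unit[OF assms(2)] by simp
  fix A B assume AB: "T dvd A * B"
  obtain E E' where E: "bounded_by E A" "bounded_by E' B" using exists_bounded_by by blast
  then have "S dvd reflect E A * reflect E' B"
    using AB dvd[OF bounded_by_mult[OF E]] by (simp add: reflect_mult)
  then show "T dvd A \<or> T dvd B"
    using assms(2) dvd E by (simp add: prime_elem_dvd_mult_iff)
qed

lemma exists_reflects:
  assumes "\<And>i. \<not> X i dvd S" "homogeneous d S"
  obtains D T e where "reflects D S T" "homogeneous e T"
proof -
  let ?K = "Poly_Mapping.keys S"
  \<comment> \<open>The entrywise maximum over the support is the least bound: in each variable it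
    is attained by some \<open>\<alpha>\<close>, whose reflection is then free of that
    variable.\<close>
  define D where "D = (\<Sum>i\<in>UNIV. Poly_Mapping.single i (Max ((\<lambda>\<alpha>. Poly_Mapping.lookup \<alpha> i) ` ?K)))"
  have D: "Poly_Mapping.lookup D i = Max ((\<lambda>\<alpha>. Poly_Mapping.lookup \<alpha> i) ` ?K)" for i
    by (simp add: D_def lookup_sum lookup_single when_def)
  have "?K \<noteq> {}" using assms(1) by auto
  have le: "Poly_Mapping.lookup \<alpha> i \<le> Poly_Mapping.lookup D i" if "\<alpha> \<in> ?K" for \<alpha> i
    using that by (simp add: D)
  then have D_diff: "D = \<alpha> + (D - \<alpha>)" if "\<alpha> \<in> ?K" for \<alpha>
    using that by (intro poly_mapping_eqI) (simp add: lookup_add lookup_minus)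
  then have b: "bounded_by D S" unfolding bounded_by_def by blast
  have "\<not> X i dvd reflect D S" for i
  proof -
    have "Poly_Mapping.lookup D i \<in> (\<lambda>\<alpha>. Poly_Mapping.lookup \<alpha> i) ` ?K"
      unfolding D using \<open>?K \<noteq> {}\<close> by (intro Max_in) auto
    then obtain \<alpha> where "\<alpha> \<in> ?K" "Poly_Mapping.lookup \<alpha> i = Poly_Mapping.lookup D i" by auto
    then show ?thesis
      by (auto simp: X_dvd_iff keys_reflect[OF b] lookup_minus intro!: bexI[of _ \<alpha>])
  qed
  then have "reflects D S (reflect D S)" using b assms(1) by (simp add: reflects_def)
  moreover have "homogeneous (mdeg D - d) (reflect D S)"
    unfolding homogeneous_def keys_reflect[OF b]
  proof clarify
    fix \<alpha> assume "\<alpha> \<in> ?K"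
    then show "mdeg (D - \<alpha>) = mdeg D - d"
      using assms(2) arg_cong[OF D_diff, of \<alpha> mdeg] by (simp add: homogeneous_def mdeg_add)
  qed
  ultimately show thesis by (rule that)
qed

section \<open>The Cremona transformation on forms and points\<close>

definition const_exp :: "nat \<Rightarrow> 4 \<Rightarrow>\<^sub>0 nat" where
  "const_exp n = (\<Sum>i\<in>UNIV. Poly_Mapping.single i n)"

lemma lookup_const_exp [simp]: "Poly_Mapping.lookup (const_exp n) i = n"
  by (simp add: const_exp_def lookup_sum lookup_single when_def)

lemma const_exp_add: "const_exp (m + n) = const_exp m + const_exp n"
  by (rule poly_mapping_eqI) (simp add: lookup_add)

lemma homogeneous_bounded_by:
  assumes "homogeneous d F" shows "bounded_by (const_exp d) F"
  unfolding bounded_by_def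
proof
  fix \<alpha> assume "\<alpha> \<in> Poly_Mapping.keys F"
  then have "mdeg \<alpha> = d" using assms by (simp add: homogeneous_def)
  then have "Poly_Mapping.lookup \<alpha> i \<le> d" for i
    using member_le_sum[of i UNIV "Poly_Mapping.lookup \<alpha>"] by simp
  then have "const_exp d = \<alpha> + (const_exp d - \<alpha>)"
    by (intro poly_mapping_eqI) (simp add: lookup_add lookup_minus)
  then show "\<exists>\<beta>. const_exp d = \<alpha> + \<beta>" by blast
qed

text \<open>In the pull-back of a monomial of degree \<open>d\<close>, the variable
  \<open>X j\<close> occurs in the factors for all \<open>i \<noteq> j\<close>. Its new exponent is
  the sum of the other three old ones, that is, \<open>d\<close> minus its own.\<close>

lemma Cr_pullback_eq_reflect:
  assumes "homogeneous d F" shows "Cr_pullback F = reflect (const_exp d) F"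
  unfolding Cr_pullback_def subst_def reflect_def
proof (rule sum.cong)
  fix \<alpha> assume "\<alpha> \<in> Poly_Mapping.keys F"
  then have d: "mdeg \<alpha> = d" using assms by (simp add: homogeneous_def)
  have "(\<Prod>i\<in>UNIV. (\<Prod>j\<in>UNIV - {i}. X j) ^ Poly_Mapping.lookup \<alpha> i) =
     (\<Prod>i\<in>UNIV. \<Prod>j\<in>UNIV. if j \<noteq> i then X j ^ Poly_Mapping.lookup \<alpha> i else (1 :: 'a quaternary))"
    unfolding prod_power_distrib by (intro prod.cong prod.mono_neutral_cong_left) auto
  also have "\<dots> = (\<Prod>j\<in>UNIV. \<Prod>i\<in>UNIV. if j \<noteq> i then X j ^ Poly_Mapping.lookup \<alpha> i else 1)"
    by (rule prod.swap)
  also have "\<dots> = (\<Prod>j\<in>UNIV. X j ^ Poly_Mapping.lookup (const_exp d - \<alpha>) j)"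
  proof (rule prod.cong)
    fix j :: 4
    have "(\<Prod>i\<in>UNIV. if j \<noteq> i then X j ^ Poly_Mapping.lookup \<alpha> i else (1 :: 'a quaternary)) =
      (\<Prod>i\<in>UNIV - {j}. X j ^ Poly_Mapping.lookup \<alpha> i)"
      by (rule prod.mono_neutral_cong_right) auto
    also have "\<dots> = X j ^ (\<Sum>i\<in>UNIV - {j}. Poly_Mapping.lookup \<alpha> i)"
      by (rule power_sum[symmetric])
    also have "(\<Sum>i\<in>UNIV - {j}. Poly_Mapping.lookup \<alpha> i) = d - Poly_Mapping.lookup \<alpha> j"
      using d sum.remove[of UNIV j "Poly_Mapping.lookup \<alpha>"] by simp
    finally show "(\<Prod>i\<in>UNIV. if j \<noteq> i then X j ^ Poly_Mapping.lookup \<alpha> i else (1 :: 'a quaternary)) =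
      X j ^ Poly_Mapping.lookup (const_exp d - \<alpha>) j" by (simp add: lookup_minus)
  qed simp
  finally show "const (Poly_Mapping.lookup F \<alpha>) * (\<Prod>i\<in>UNIV. (\<Prod>j\<in>UNIV - {i}. X j) ^ Poly_Mapping.lookup \<alpha> i) =
     Poly_Mapping.single (const_exp d - \<alpha>) (Poly_Mapping.lookup F \<alpha>)"
    by (simp add: prod_X_power const_times_single)
qed simp

lemma homogeneous_Cr_pullback:
  assumes "homogeneous d F" shows "homogeneous (3 * d) (Cr_pullback F)"
proof -
  have "homogeneous 3 (\<Prod>j\<in>UNIV - {i}. X j :: 'a quaternary)" for i
    using homogeneous_prod[of "UNIV - {i}" "\<lambda>_. Suc 0" X] by (simp add: card_Diff_singleton)
  then show ?thesis
    unfolding Cr_pullback_def mult.commute[of 3] by (rule homogeneous_subst[OF assms])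
qed

text \<open>The first pull-back has degree \<open>3 * d\<close>, so the second reflects at
  \<open>3 * d\<close> instead of \<open>d\<close>; the surplus \<open>2 * d\<close> in every
  variable is the monomial factor.\<close>

lemma Cr_pullback_Cr_pullback:
  assumes "homogeneous d F"
  shows "Cr_pullback (Cr_pullback F) = Poly_Mapping.single (const_exp (2 * d)) 1 * F"
proof -
  have b: "bounded_by (const_exp d) F" by (rule homogeneous_bounded_by[OF assms])
  have "Cr_pullback (Cr_pullback F) = reflect (const_exp (2 * d) + const_exp d) (reflect (const_exp d) F)"
    using Cr_pullback_eq_reflect[OF homogeneous_Cr_pullback[OF assms]]
    by (simp add: Cr_pullback_eq_reflect[OF assms] flip: const_exp_add)
  then show ?thesis
    by (simp add: reflect_add_bound[OF bounded_by_reflect[OF b]] reflect_reflect[OF b])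
qed

lemma single_1_neq_0 [simp]: "Poly_Mapping.single \<alpha> (1::'a::field) \<noteq> 0"
  by (metis keys_single keys_zero insert_not_empty zero_neq_one)

lemma Cr_pullback_eq_0_iff:
  assumes "homogeneous d F" shows "Cr_pullback F = 0 \<longleftrightarrow> F = 0"
proof
  assume "Cr_pullback F = 0"
  then show "F = 0" using Cr_pullback_Cr_pullback[OF assms] by (simp add: Cr_pullback_def)
qed (simp add: Cr_pullback_def)

text \<open>The greatest exponent exists because \<open>S\<close> vanishes at the origin: if
  \<open>S ^ n\<close> divides \<open>F\<close>, then \<open>F\<close> has order at least
  \<open>n\<close> there, and a nonzero polynomial has bounded order.\<close>

lemma le_ord_along_iff:
  assumes "F \<noteq> 0" "order_ge 1 S" shows "n \<le> ord_along S F \<longleftrightarrow> S ^ n dvd F"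
proof -
  obtain b where b: "\<And>n. order_ge n F \<Longrightarrow> n \<le> b" using order_ge_bounded[OF assms(1)] by blast
  have bound: "n \<le> b" if dvd: "S ^ n dvd F" for n
  proof -
    obtain Q where "F = S ^ n * Q" using dvd by (auto elim: dvdE)
    then have "order_ge n F"
      using order_ge_mult[OF order_ge_power[OF assms(2), of n] order_ge_0] by simp
    then show ?thesis by (rule b)
  qed
  have "S ^ ord_along S F dvd F"
    unfolding ord_along_def by (rule GreatestI_nat[of _ 0 b]) (auto intro: bound)
  then have "S ^ n dvd F" if "n \<le> ord_along S F"
    using le_imp_power_dvd[OF that] dvd_trans by blast
  moreover have "n \<le> ord_along S F" if "S ^ n dvd F"
    unfolding ord_along_def using that by (rule Greatest_le_nat[of _ _ b]) (auto intro: bound)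
  ultimately show ?thesis by blast
qed

section \<open>Coordinate planes against coordinate points\<close>

lemma order_ge_1_X: "order_ge 1 (X i)"
  by (simp add: order_ge_def X_def)

text \<open>In the chart where the \<open>i\<close>-th coordinate is \<open>1\<close>, a monomial of
  degree \<open>d\<close> loses its power of \<open>X i\<close>, and distinct monomials stay
  distinct. The multiplicity is thus \<open>d\<close> minus the largest exponent of
  \<open>X i\<close>.\<close>

lemma le_mult_at_axis_iff:
  assumes F: "homogeneous d F" "F \<noteq> 0"
  shows "n \<le> mult_at (axis i 1) F \<longleftrightarrow> (\<forall>\<alpha>\<in>Poly_Mapping.keys F. Poly_Mapping.lookup \<alpha> i + n \<le> d)"
proof -
  have deg: "mdeg \<alpha> = Poly_Mapping.lookup \<alpha> i + (\<Sum>j\<in>UNIV - {i}. Poly_Mapping.lookup \<alpha> j)" for \<alpha>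
    by (simp add: sum.remove[of UNIV i])
  define drop where "drop \<alpha> = \<alpha> - Poly_Mapping.single i (Poly_Mapping.lookup \<alpha> i)" for \<alpha> :: "4 \<Rightarrow>\<^sub>0 nat"
  have drop: "\<alpha> = Poly_Mapping.single i (Poly_Mapping.lookup \<alpha> i) + drop \<alpha>" for \<alpha>
    by (rule poly_mapping_eqI) (auto simp: drop_def lookup_add lookup_minus lookup_single when_def)
  have deg_drop: "mdeg \<alpha> = Poly_Mapping.lookup \<alpha> i + mdeg (drop \<alpha>)" for \<alpha>
    using arg_cong[OF drop, of mdeg \<alpha>] by (simp add: mdeg_add)
  let ?Z = "\<lambda>j. X j + const (axis i 1 $ j) :: 'a quaternary"
  have "order_ge n (subst ?Z F) \<longleftrightarrow> (\<forall>\<alpha>\<in>Poly_Mapping.keys F. Poly_Mapping.lookup \<alpha> i + n \<le> d)"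
  proof
    assume *: "\<forall>\<alpha>\<in>Poly_Mapping.keys F. Poly_Mapping.lookup \<alpha> i + n \<le> d"
    show "order_ge n (subst ?Z F)" unfolding subst_def
    proof (rule order_ge_sum)
      fix \<alpha> assume \<alpha>: "\<alpha> \<in> Poly_Mapping.keys F"
      have "order_ge (\<Sum>j\<in>UNIV. if j = i then 0 else Poly_Mapping.lookup \<alpha> j) (\<Prod>j\<in>UNIV. ?Z j ^ Poly_Mapping.lookup \<alpha> j)"
        using order_ge_power[OF order_ge_1_X] by (intro order_ge_prod) (auto simp: axis_def)
      also have "(\<Sum>j\<in>UNIV. if j = i then 0 else Poly_Mapping.lookup \<alpha> j) = (\<Sum>j\<in>UNIV - {i}. Poly_Mapping.lookup \<alpha> j)"
        by (rule sum.mono_neutral_cong_right) auto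
      finally have ord: "order_ge (\<Sum>j\<in>UNIV - {i}. Poly_Mapping.lookup \<alpha> j) (\<Prod>j\<in>UNIV. ?Z j ^ Poly_Mapping.lookup \<alpha> j)" .
      have "mdeg \<alpha> = d" using F(1) \<alpha> by (simp add: homogeneous_def)
      moreover have "Poly_Mapping.lookup \<alpha> i + n \<le> d" using * \<alpha> by blast
      then have "n \<le> (\<Sum>j\<in>UNIV - {i}. Poly_Mapping.lookup \<alpha> j)"
        using deg[of \<alpha>] \<open>mdeg \<alpha> = d\<close> by linarith
      then have "order_ge n (\<Prod>j\<in>UNIV. ?Z j ^ Poly_Mapping.lookup \<alpha> j)"
        by (rule order_ge_mono[OF ord])
      then show "order_ge n (const (Poly_Mapping.lookup F \<alpha>) * (\<Prod>j\<in>UNIV. ?Z j ^ Poly_Mapping.lookup \<alpha> j))"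
        using order_ge_mult[OF order_ge_0] by fastforce
    qed
  next
    assume *: "order_ge n (subst ?Z F)"
    let ?W = "\<lambda>j. if j = i then 1 else X j :: 'a quaternary"
    \<comment> \<open>Setting \<open>X i\<close> to zero after the translation restricts to this
      chart, since it amounts to substituting \<open>1\<close> for \<open>X i\<close> in
      \<open>F\<close>. The order cannot drop.\<close>
    have "order_ge n (subst (\<lambda>j. if j = i then 0 else X j) (subst ?Z F))"
      using order_ge_1_X by (intro order_ge_subst[OF *]) auto
    moreover have "(\<lambda>j. subst (\<lambda>j. if j = i then 0 else X j) (?Z j)) = ?W"
      by (rule ext) (simp add: subst_add axis_def)
    ultimately have W: "order_ge n (subst ?W F)" by (simp add: subst_subst)
    have prod_W: "(\<Prod>j\<in>UNIV. ?W j ^ Poly_Mapping.lookup \<alpha> j) = Poly_Mapping.single (drop \<alpha>) 1" for \<alpha>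
    proof -
      have "(\<Prod>j\<in>UNIV. ?W j ^ Poly_Mapping.lookup \<alpha> j) = (\<Prod>j\<in>UNIV. X j ^ Poly_Mapping.lookup (drop \<alpha>) j)"
        by (rule prod.cong) (auto simp: drop_def lookup_minus lookup_single when_def)
      then show ?thesis by (simp add: prod_X_power)
    qed
    show "\<forall>\<alpha>\<in>Poly_Mapping.keys F. Poly_Mapping.lookup \<alpha> i + n \<le> d"
    proof
      fix \<alpha> assume \<alpha>: "\<alpha> \<in> Poly_Mapping.keys F"
      \<comment> \<open>As the degree is fixed, the exponent of \<open>X i\<close> is recovered from
        the others, and no two terms of \<open>F\<close> merge in the chart.\<close>
      have inj: "\<beta> = \<alpha>" if "\<beta> \<in> Poly_Mapping.keys F" "drop \<beta> = drop \<alpha>" for \<beta>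
      proof -
        have "mdeg \<beta> = mdeg \<alpha>" using F(1) \<alpha> that(1) by (simp add: homogeneous_def)
        then have "Poly_Mapping.lookup \<beta> i = Poly_Mapping.lookup \<alpha> i"
          using that(2) deg_drop[of \<alpha>] deg_drop[of \<beta>] by simp
        then show ?thesis using drop[of \<alpha>] drop[of \<beta>] that(2) by metis
      qed
      have "Poly_Mapping.lookup (subst ?W F) (drop \<alpha>) =
          (\<Sum>\<beta>\<in>Poly_Mapping.keys F. if drop \<beta> = drop \<alpha> then Poly_Mapping.lookup F \<beta> else 0)"
        unfolding subst_def prod_W const_times_single lookup_sum
        by (simp add: lookup_single when_def)
      also have "\<dots> = (\<Sum>\<beta>\<in>Poly_Mapping.keys F. if \<beta> = \<alpha> then Poly_Mapping.lookup F \<beta> else 0)"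
        using inj by (intro sum.cong) auto
      also have "\<dots> = Poly_Mapping.lookup F \<alpha>" using \<alpha> by simp
      finally have "drop \<alpha> \<in> Poly_Mapping.keys (subst ?W F)" using \<alpha> by (simp add: in_keys_iff)
      then have "n \<le> mdeg (drop \<alpha>)" using W by (simp add: order_ge_def)
      moreover have "mdeg \<alpha> = d" using F(1) \<alpha> by (simp add: homogeneous_def)
      ultimately show "Poly_Mapping.lookup \<alpha> i + n \<le> d" using deg_drop[of \<alpha>] by simp
    qed
  qed
  then show ?thesis by (simp add: le_mult_at_iff[OF F(2)])
qed

text \<open>The order along \<open>X i\<close> is the least exponent of \<open>X i\<close>. After
  reflection this is \<open>d\<close> minus the largest old exponent, which is the multiplicity at
  the coordinate point.\<close>

lemma ord_along_X_Cr_pullback: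
  assumes "homogeneous d F" "F \<noteq> 0"
  shows "ord_along (X i) (Cr_pullback F) = mult_at (axis i 1) F"
proof -
  have b: "bounded_by (const_exp d) F" by (rule homogeneous_bounded_by[OF assms(1)])
  have "n \<le> ord_along (X i) (Cr_pullback F) \<longleftrightarrow> n \<le> mult_at (axis i 1) F" for n
  proof -
    have "Cr_pullback F \<noteq> 0" using assms Cr_pullback_eq_0_iff by blast
    then have "n \<le> ord_along (X i) (Cr_pullback F) \<longleftrightarrow>
        (\<forall>\<alpha>\<in>Poly_Mapping.keys F. n \<le> d - Poly_Mapping.lookup \<alpha> i)"
      by (simp add: le_ord_along_iff[OF _ order_ge_1_X] X_power_dvd_iff Cr_pullback_eq_reflect[OF assms(1)]
          keys_reflect[OF b] lookup_minus)
    moreover have "Poly_Mapping.lookup \<alpha> i \<le> d" if "\<alpha> \<in> Poly_Mapping.keys F" for \<alpha>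
      using that b by (auto simp: bounded_by_def dest!: bspec arg_cong[of _ _ "\<lambda>f. Poly_Mapping.lookup f i"] simp: lookup_add)
    ultimately show ?thesis
      unfolding le_mult_at_axis_iff[OF assms] by (metis add.commute le_diff_conv2)
  qed
  then show ?thesis by (metis order_refl le_antisym)
qed

section \<open>Scaling of representatives, and points outside the coordinate planes\<close>

lemma mult_at_scale_le:
  assumes "homogeneous d F" "F \<noteq> 0" "c \<noteq> 0"
  shows "mult_at (\<chi> i. c * x $ i) F \<le> mult_at x F"
proof -
  \<comment> \<open>Scaling the point is realized by a linear substitution, which multiplies the
    form by the nonzero constant \<open>c ^ d\<close>.\<close>
  have eq: "subst (\<lambda>i. const c * X i) F = const (c ^ d) * F"
    by (simp add: homogeneous_subst_scale[OF assms(1)] const_power)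
  have "mult_at (\<chi> i. c * x $ i) F \<le> mult_at x (subst (\<lambda>i. const c * X i) F)"
    by (rule mult_at_subst_ge) (simp_all only: eq order_ge_1_translate_iff, simp_all add: assms subst_mult const_mult)
  also have "\<dots> = mult_at x F"
    using assms mult_at_mult[of "const (c ^ d)" F x] mult_at_eq_0_iff[of "const (c ^ d)" x] by (simp add: eq)
  finally show ?thesis .
qed

lemma mult_at_scale:
  assumes "homogeneous d F" "F \<noteq> 0" "c \<noteq> 0"
  shows "mult_at (\<chi> i. c * x $ i) F = mult_at x F"
proof (rule antisym[OF mult_at_scale_le[OF assms]])
  have "(\<chi> i. inverse c * (\<chi> i. c * x $ i) $ i) = x"
    using assms(3) by (simp add: vec_eq_iff flip: mult.assoc)
  then show "mult_at x F \<le> mult_at (\<chi> i. c * x $ i) F"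
    using mult_at_scale_le[OF assms(1,2), of "inverse c" "\<chi> i. c * x $ i"] assms(3) by simp
qed

lemma mult_at_Cr_point_le:
  assumes F: "homogeneous d F" "F \<noteq> 0" and x: "\<And>i. x $ i \<noteq> 0"
  shows "mult_at (Cr_point x) F \<le> mult_at x (Cr_pullback F)"
proof -
  \<comment> \<open>The cubic forms take \<open>x\<close> to \<open>Cr_point x\<close> times the
    product of all coordinates of \<open>x\<close>, another representative of the same
    point.\<close>
  define c where "c = (\<Prod>j\<in>UNIV. x $ j)"
  have c: "c \<noteq> 0" using x by (simp add: c_def)
  have "c * inverse (x $ i) = (\<Prod>j\<in>UNIV - {i}. x $ j)" for i
    using x prod.remove[of UNIV i "\<lambda>j. x $ j"] by (simp add: c_def)
  then have "mult_at (\<chi> i. c * Cr_point x $ i) F \<le> mult_at x (Cr_pullback F)"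
    unfolding Cr_pullback_def
    by (intro mult_at_subst_ge, unfold order_ge_1_translate_iff)
       (use F Cr_pullback_eq_0_iff[OF F(1)] in \<open>auto simp: Cr_pullback_def Cr_point_def subst_prod const_prod\<close>)
  then show ?thesis by (simp add: mult_at_scale[OF F c])
qed

lemma Cr_point_Cr_point [simp]: "Cr_point (Cr_point x) = x"
  by (simp add: Cr_point_def vec_eq_iff)

text \<open>The missing inequality is the known one for \<open>Cr_point x\<close> and the pull-back
  of \<open>F\<close>: pulling back twice only adds the monomial \<open>?M\<close>, which does not
  vanish at a point with nonzero coordinates.\<close>

lemma mult_at_Cr_pullback:
  assumes F: "homogeneous d F" "F \<noteq> 0" and x: "\<And>i. x $ i \<noteq> 0"
  shows "mult_at x (Cr_pullback F) = mult_at (Cr_point x) F"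
proof (rule antisym)
  let ?M = "Poly_Mapping.single (const_exp (2 * d)) 1 :: 'a quaternary"
  have x': "Cr_point x $ i \<noteq> 0" for i using x by (simp add: Cr_point_def)
  have "mult_at x (Cr_pullback F) \<le> mult_at (Cr_point x) (?M * F)"
    using mult_at_Cr_point_le[OF homogeneous_Cr_pullback[OF F(1)] _ x'] F
    by (simp add: Cr_pullback_eq_0_iff Cr_pullback_Cr_pullback)
  also have "mult_at (Cr_point x) ?M = 0"
    using x' by (subst mult_at_eq_0_iff) (simp_all add: subst_single flip: const_power const_prod)
  then have "mult_at (Cr_point x) (?M * F) = mult_at (Cr_point x) F"
    using F by (simp add: mult_at_mult)
  finally show "mult_at x (Cr_pullback F) \<le> mult_at (Cr_point x) F" .
qed (rule mult_at_Cr_point_le[OF assms])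

section \<open>Prime divisors as valuations\<close>

lemma lookup_const_mult: "Poly_Mapping.lookup (const c * F) \<alpha> = c * Poly_Mapping.lookup F \<alpha>"
  for F :: "'a::field quaternary"
  by (induction F rule: additive_induct)
     (simp_all add: distrib_left lookup_add const_times_single lookup_single when_def)

lemma lookup_mult_order_ge_1:
  fixes S Q :: "'a::field quaternary"
  assumes "order_ge 1 S" "mdeg \<alpha> = 1"
  shows "Poly_Mapping.lookup (S * Q) \<alpha> = Poly_Mapping.lookup S \<alpha> * Poly_Mapping.lookup Q 0"
proof -
  define R where "R = Q - const (Poly_Mapping.lookup Q 0)"
  have "order_ge 1 R"
    unfolding order_ge_1_iff by (simp add: R_def lookup_minus const_def)
  then have "Poly_Mapping.lookup (S * R) \<alpha> = 0"
    using order_geD[OF order_ge_mult[OF assms(1)], of 1 R \<alpha>] assms(2) by simp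
  moreover have "S * Q = const (Poly_Mapping.lookup Q 0) * S + S * R"
    by (simp add: R_def algebra_simps)
  ultimately show ?thesis by (simp add: lookup_add lookup_const_mult)
qed

text \<open>The linear part of any multiple of \<open>S\<close> is a scalar multiple of the linear
  part of \<open>S\<close>. Hence the linear part of \<open>L'\<close> is a multiple of that of
  \<open>L\<close>, which is nonzero.\<close>

lemma common_factor_of_linear_forms:
  fixes S :: "'a::field quaternary"
  assumes S: "order_ge 1 S" "S dvd L" "S dvd L'"
    and deg: "mdeg \<alpha> = 1" "mdeg \<beta> = 1"
    and L: "Poly_Mapping.lookup L \<alpha> \<noteq> 0" "Poly_Mapping.lookup L \<beta> = 0"
  shows "Poly_Mapping.lookup L' \<beta> = 0"
proof -
  obtain Q Q' where Q: "L = S * Q" "L' = S * Q'" using S by (auto elim!: dvdE)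
  have "Poly_Mapping.lookup S \<beta> = 0"
    using L lookup_mult_order_ge_1[OF S(1) deg(1), of Q] lookup_mult_order_ge_1[OF S(1) deg(2), of Q]
    by (auto simp: Q)
  then show ?thesis using lookup_mult_order_ge_1[OF S(1) deg(2), of Q'] by (simp add: Q)
qed

lemma lookup_X: "Poly_Mapping.lookup (X i) (Poly_Mapping.single j 1) = (if i = j then 1 else 0)"
proof -
  have "Poly_Mapping.single i (1::nat) = Poly_Mapping.single j 1 \<longleftrightarrow> i = j"
    by (metis lookup_single_eq lookup_single_not_eq zero_neq_one)
  then show ?thesis by (simp add: X_def lookup_single when_def)
qed

lemma exists_X_not_dvd:
  assumes "order_ge 1 S" obtains i where "\<not> S dvd (X i :: 'a::field quaternary)"
proof -
  have "\<not> (S dvd X 0 \<and> S dvd X 1)"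
    using common_factor_of_linear_forms[OF assms, of "X 0" "X 1" "Poly_Mapping.single 0 1" "Poly_Mapping.single 1 1"]
    unfolding lookup_X by auto
  then show thesis using that by blast
qed

text \<open>A form with nonzero constant term has degree \<open>0\<close>, so it is a nonzero
  constant and hence a unit.\<close>

lemma order_ge_1_prime_form:
  fixes S :: "'a::field quaternary"
  assumes "prime_elem S" "homogeneous d S" shows "order_ge 1 S"
proof (rule ccontr)
  assume "\<not> order_ge 1 S"
  then have c: "Poly_Mapping.lookup S 0 \<noteq> 0" unfolding order_ge_1_iff .
  then have "mdeg 0 = d" using assms(2) unfolding homogeneous_def by (metis in_keys_iff)
  then have "d = 0" by simp
  have "\<alpha> = 0" if "\<alpha> \<in> Poly_Mapping.keys S" for \<alpha>
  proof (rule poly_mapping_eqI)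
    have "mdeg \<alpha> = 0" using that assms(2) \<open>d = 0\<close> by (simp add: homogeneous_def)
    then show "Poly_Mapping.lookup \<alpha> i = Poly_Mapping.lookup 0 i" for i by simp
  qed
  then have "S = const (Poly_Mapping.lookup S 0)"
    by (intro poly_mapping_eqI) (auto simp: const_def lookup_single when_def in_keys_iff)
  then have "S * const (inverse (Poly_Mapping.lookup S 0)) = 1"
    using c by (metis const_1 const_mult right_inverse)
  then show False using prime_elem_not_unit[OF assms(1)] by (metis dvd_triv_left)
qed

lemma ord_along_decompose:
  assumes "F \<noteq> 0" "order_ge 1 S" obtains F' where "F = S ^ ord_along S F * F'" "\<not> S dvd F'"
proof -
  obtain F' where F': "F = S ^ ord_along S F * F'"
    using le_ord_along_iff[OF assms, of "ord_along S F"] by (auto elim: dvdE)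
  have "\<not> S dvd F'"
  proof
    assume "S dvd F'"
    then have "S ^ Suc (ord_along S F) dvd F"
      by (subst F') (simp add: mult.commute mult_dvd_mono)
    then show False using le_ord_along_iff[OF assms, of "Suc (ord_along S F)"] by simp
  qed
  then show thesis using F' that by blast
qed

lemma ord_along_mult:
  assumes "prime_elem S" "order_ge 1 S" "F \<noteq> 0" "G \<noteq> 0"
  shows "ord_along S (F * G) = ord_along S F + ord_along S G" (is "_ = ?a + ?b")
proof -
  obtain F' where F': "F = S ^ ?a * F'" "\<not> S dvd F'" by (rule ord_along_decompose[OF assms(3,2)])
  obtain G' where G': "G = S ^ ?b * G'" "\<not> S dvd G'" by (rule ord_along_decompose[OF assms(4,2)])
  have FG: "F * G = S ^ (?a + ?b) * (F' * G')"
    by (subst F', subst G') (simp add: power_add mult_ac)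
  have le: "n \<le> ord_along S (F * G) \<longleftrightarrow> S ^ n dvd F * G" for n
    using assms by (intro le_ord_along_iff) auto
  have "\<not> S ^ Suc (?a + ?b) dvd F * G"
  proof
    assume "S ^ Suc (?a + ?b) dvd F * G"
    then have "S ^ (?a + ?b) * S dvd S ^ (?a + ?b) * (F' * G')" by (simp add: FG mult.commute)
    then have "S dvd F' * G'" using assms(1) by simp
    then show False using F' G' assms(1) by (simp add: prime_elem_dvd_mult_iff)
  qed
  then have "\<not> Suc (?a + ?b) \<le> ord_along S (F * G)" by (simp only: le not_False_eq_True)
  moreover have "?a + ?b \<le> ord_along S (F * G)" unfolding le by (simp add: FG)
  ultimately show ?thesis by linarith
qed

lemma ord_along_eq_0_iff:
  assumes "F \<noteq> 0" "order_ge 1 S" shows "ord_along S F = 0 \<longleftrightarrow> \<not> S dvd F"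
  using le_ord_along_iff[OF assms, of 1] by auto

text \<open>If one prime divides another, they divide each other, and their powers have the same
  multiples. Associated equations thus give literally the same function, so a surface is one prime
  divisor.\<close>

lemma ord_along_prime_cong:
  fixes S T :: "'a::field quaternary"
  assumes "prime_elem S" "prime_elem T" "T dvd S" shows "ord_along S = ord_along T"
proof -
  obtain Q where Q: "S = T * Q" using assms(3) by (auto elim: dvdE)
  have "S dvd T"
  proof (rule ccontr)
    assume "\<not> S dvd T"
    then have "S dvd Q" using Q assms(1) by (metis dvd_refl prime_elem_dvd_mult_iff)
    then obtain R where R: "Q = S * R" by (auto elim: dvdE)
    have "S * (T * R) = T * (S * R)" by (simp only: mult_ac)
    also have "\<dots> = S * 1" unfolding R[symmetric] Q[symmetric] by simp
    finally have "S * (T * R) = S * 1" .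
    moreover have "S \<noteq> 0" using assms(1) by auto
    ultimately have "T * R = 1" by (metis mult_left_cancel)
    then show False using prime_elem_not_unit[OF assms(2)] by (metis dvd_triv_left)
  qed
  then have "S ^ n dvd F \<longleftrightarrow> T ^ n dvd F" for n F
    using assms(3) dvd_power_same dvd_trans by blast
  then show ?thesis by (simp add: ord_along_def fun_eq_iff)
qed

text \<open>The rational function \<open>F / G\<close> has positive valuation along \<open>v\<close>
  and nonpositive valuation along \<open>w\<close>. By contrast, \<open>v \<noteq> w\<close> alone
  says nothing about quotients of forms.\<close>

definition separated :: "('a::field) prime_divisor \<Rightarrow> 'a prime_divisor \<Rightarrow> bool" where
  "separated v w \<longleftrightarrow> (\<exists>d F G. homogeneous d F \<and> homogeneous d G \<and> F \<noteq> 0 \<and> G \<noteq> 0 \<and>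
     v F > v G \<and> w F \<le> w G)"

lemma separated_ord_ord:
  fixes S T :: "'a::field quaternary"
  assumes S: "prime_elem S" "homogeneous d S" and T: "prime_elem T" "homogeneous e T"
    and "\<not> T dvd S"
  shows "separated (ord_along S) (ord_along T)"
proof -
  have ge: "order_ge 1 S" "order_ge 1 T" using order_ge_1_prime_form S T by blast+
  \<comment> \<open>The separating function is \<open>S / X i ^ d\<close>: it vanishes along
    \<open>S = 0\<close> but not along \<open>T = 0\<close>.\<close>
  obtain i where i: "\<not> S dvd X i" using exists_X_not_dvd[OF ge(1)] by blast
  have "S \<noteq> 0" "X i ^ d \<noteq> (0 :: 'a quaternary)" using S by auto
  moreover have "homogeneous d (X i ^ d :: 'a quaternary)"
    using homogeneous_power[OF homogeneous_X, of d] by simp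
  moreover have "\<not> S dvd X i ^ d" using i S(1) prime_elem_dvd_power by blast
  then have "ord_along S (X i ^ d) = 0" using ge by (simp add: ord_along_eq_0_iff)
  moreover have "1 \<le> ord_along S S" using \<open>S \<noteq> 0\<close> by (subst le_ord_along_iff[OF _ ge(1)]) auto
  moreover have "ord_along T S = 0" using assms(5) \<open>S \<noteq> 0\<close> ge by (simp add: ord_along_eq_0_iff)
  ultimately show ?thesis
    unfolding separated_def using S(2)
    by (intro exI[of _ d] exI[of _ S] exI[of _ "X i ^ d"]) auto
qed

text \<open>Up to sign, the minor in columns \<open>a\<close> and \<open>b\<close> of the matrix
  with rows \<open>x\<close> and \<open>(X 0, ..., X 3)\<close>. When nonzero, it defines a plane
  through the point \<open>x\<close>.\<close>

definition line :: "'a::field ^ 4 \<Rightarrow> 4 \<Rightarrow> 4 \<Rightarrow> 'a quaternary" where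
  "line x a b = const (x $ b) * X a - const (x $ a) * X b"

lemma homogeneous_line: "homogeneous 1 (line x a b)"
proof -
  have "homogeneous 1 (const c * X i :: 'a quaternary)" for c i
    using homogeneous_mult[OF homogeneous_const homogeneous_X, of c i] by simp
  from homogeneous_add[OF this[of "x $ b" a] this[of "- (x $ a)" b]] show ?thesis
    by (simp add: line_def const_def single_uminus)
qed

lemma eval_at_line: "eval_at y (line x a b) = const (x $ b * y $ a - x $ a * y $ b)"
proof -
  have "const (u - v) = const u - const v" for u v :: 'a
    by (simp add: const_def single_diff)
  then show ?thesis by (simp add: line_def subst_diff subst_mult const_mult)
qed

lemma lookup_line:
  "Poly_Mapping.lookup (line x a b) (Poly_Mapping.single j 1) =
     (if a = j then x $ b else 0) - (if b = j then x $ a else 0)"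
  by (simp add: line_def lookup_minus lookup_const_mult lookup_X del: One_nat_def)

lemma mult_at_X_eq_0: "x $ a \<noteq> 0 \<Longrightarrow> mult_at x (X a) = 0"
  by (subst mult_at_eq_0_iff) simp_all

lemma mult_at_line_self: "line x a b \<noteq> 0 \<Longrightarrow> mult_at x (line x a b) \<noteq> 0"
  by (subst mult_at_eq_0_iff) (simp_all add: eval_at_line mult.commute)

lemma separated_mult_ord:
  fixes x :: "'a::field ^ 4"
  assumes "x \<noteq> 0" and S: "order_ge 1 S"
  shows "separated (mult_at x) (ord_along S)"
proof -
  obtain a where a: "x $ a \<noteq> 0" using assms(1) by (auto simp: vec_eq_iff)
  \<comment> \<open>Indices are added in the type \<open>4\<close>, so these are three distinct
    coordinates. The resulting two planes through \<open>x\<close> have independent equations, and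
    \<open>S\<close> divides at most one of them.\<close>
  have ne: "a + 1 \<noteq> a" "a + 2 \<noteq> a" "a + 1 \<noteq> a + 2" by simp_all
  have l: "Poly_Mapping.lookup (line x a b) (Poly_Mapping.single b 1) \<noteq> 0" if "b \<noteq> a" for b
    using a that unfolding lookup_line by auto
  have "Poly_Mapping.lookup (line x a (a + 1)) (Poly_Mapping.single (a + 2) 1) = 0"
    using ne unfolding lookup_line by auto
  then have "\<not> (S dvd line x a (a + 1) \<and> S dvd line x a (a + 2))"
    using common_factor_of_linear_forms[OF S _ _ mdeg_single mdeg_single l] ne l by blast
  then obtain b where b: "b \<noteq> a" "\<not> S dvd line x a b" using ne by blast
  then have nz: "line x a b \<noteq> 0" using l[of b] by auto
  have "ord_along S (line x a b) = 0" using b nz S by (simp add: ord_along_eq_0_iff)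
  then show ?thesis
    unfolding separated_def using nz mult_at_X_eq_0[OF a] mult_at_line_self[OF nz] homogeneous_line[of x a b]
    by (intro exI[of _ 1] exI[of _ "line x a b"] exI[of _ "X a"]) auto
qed

lemma separated_mult_mult:
  fixes x y :: "'a::field ^ 4"
  assumes "x \<noteq> 0" "y \<noteq> 0" "\<not> same_point x y"
  shows "separated (mult_at x) (mult_at y)"
proof -
  obtain a where a: "x $ a \<noteq> 0" using assms(1) by (auto simp: vec_eq_iff)
  \<comment> \<open>Since \<open>x $ a\<close> is nonzero, the vanishing of the minors that involve
    column \<open>a\<close> would already make \<open>y\<close> a multiple of
    \<open>x\<close>.\<close>
  have "\<exists>b. x $ b * y $ a \<noteq> x $ a * y $ b"
  proof (rule ccontr)
    assume "\<not> ?thesis"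
    then have eq: "y $ b = y $ a / x $ a * x $ b" for b using a by (simp add: field_simps)
    have "y = (\<chi> b. y $ a / x $ a * x $ b)"
      unfolding vec_eq_iff vec_lambda_beta by (rule allI, rule eq)
    moreover have "y $ a / x $ a \<noteq> 0"
      using eq assms(2) by (metis mult_zero_left vec_eq_iff zero_index)
    ultimately show False using assms(3) unfolding same_point_def by blast
  qed
  then obtain b where b: "x $ b * y $ a - x $ a * y $ b \<noteq> 0" by auto
  then have e: "eval_at y (line x a b) \<noteq> 0" by (simp add: eval_at_line)
  then have nz: "line x a b \<noteq> 0" by auto
  then have "mult_at y (line x a b) = 0" using e mult_at_eq_0_iff by blast
  then show ?thesis
    unfolding separated_def using nz mult_at_X_eq_0[OF a] mult_at_line_self[OF nz] homogeneous_line[of x a b]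
    by (intro exI[of _ 1] exI[of _ "line x a b"] exI[of _ "X a"]) auto
qed

section \<open>The action of the Cremona transformation on prime divisors\<close>

lemma Cr_points_Cr_points [simp]: "Cr_points (Cr_points p) = p"
  by (auto simp: Cr_points_def)

lemma UNIV_4_from_0: "(UNIV :: 4 set) = {0, 1, 2, 3}"
proof -
  have "card {0, 1, 2, 3 :: 4} = card (UNIV :: 4 set)" by simp
  then show ?thesis by (metis card_subset_eq finite subset_UNIV)
qed

lemma Cr_transformI:
  assumes "\<And>d F. homogeneous d F \<Longrightarrow> F \<noteq> 0 \<Longrightarrow> w F = v (Cr_pullback F)"
  shows "Cr_transform v w"
  unfolding Cr_transform_def using assms by metis

lemma Cr_transform_X: "Cr_transform (ord_along (X i)) (mult_at (axis i 1))"
  by (rule Cr_transformI) (simp add: ord_along_X_Cr_pullback)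

definition point_index :: "4 \<Rightarrow> nat" where
  "point_index i = (if i = 0 then 1 else if i = 1 then 2 else if i = 2 then 3 else 4)"

lemma bij_betw_point_index: "bij_betw point_index UNIV {1..4}"
proof -
  have image: "point_index ` UNIV = {1..4}"
    by (subst UNIV_4_from_0) (auto simp: point_index_def)
  then have "inj point_index" by (intro eq_card_imp_inj_on) simp_all
  then show ?thesis using image by (simp add: bij_betw_def)
qed

text \<open>These conditions are inherited by \<open>Cr_points p\<close>, so the locale can be
  interpreted for source and target alike, and results on one blow-up become available for the
  other.\<close>

locale blown_up_points =
  fixes r :: nat and p :: "nat \<Rightarrow> 'a::field ^ 4"
  assumes r_ge: "r \<ge> 4"
    and coordinate_points: "\<And>i. p (point_index i) = axis i 1"
    and general_points: "\<And>i j. i \<in> {5..r} \<Longrightarrow> p i $ j \<noteq> 0"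
    and distinct_points: "\<And>i j. i \<in> {1..r} \<Longrightarrow> j \<in> {1..r} \<Longrightarrow> i \<noteq> j \<Longrightarrow> \<not> same_point (p i) (p j)"
begin

lemma point_index_mem: "point_index i \<in> {1..r}" and point_index_le: "point_index i \<le> 4"
proof -
  have "point_index i \<in> {1..4}"
    using bij_betw_point_index unfolding bij_betw_def by blast
  then show "point_index i \<in> {1..r}" "point_index i \<le> 4" using r_ge by auto
qed

lemma point_cases:
  assumes "i \<in> {1..r}" obtains j where "i = point_index j" | "i \<in> {5..r}"
proof (cases "i \<le> 4")
  case True
  then have "i \<in> point_index ` UNIV" using assms bij_betw_point_index by (simp add: bij_betw_def)
  then show thesis using that(1) by blast
next
  case False
  then show thesis using assms that(2) by simp
qed

lemma point_neq_0: "i \<in> {1..r} \<Longrightarrow> p i \<noteq> 0"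
  using general_points[of i 0] by (elim point_cases) (auto simp: coordinate_points axis_eq_0_iff)

text \<open>Proportional vectors have the same zero coordinates, which tells coordinate points from
  general ones. Among general points, inverting all coordinates respects proportionality.\<close>

lemma blown_up_points_Cr: "blown_up_points r (Cr_points p)"
proof
  show "4 \<le> r" by (rule r_ge)
  show "Cr_points p (point_index i) = axis i 1" for i
    using point_index_le by (simp add: Cr_points_def coordinate_points)
  show gen: "Cr_points p i $ j \<noteq> 0" if "i \<in> {5..r}" for i j
    using general_points that by (simp add: Cr_points_def Cr_point_def)
  fix i j assume ij: "i \<in> {1..r}" "j \<in> {1..r}" "i \<noteq> j"
  have ax: "\<exists>l. p i $ l = 0" if i: "i \<in> {1..r}" "i \<le> 4" for i
  proof -
    obtain k where "p i = axis k 1"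
      using i(2) coordinate_points by (cases rule: point_cases[OF i(1)]) auto
    then have "p i $ (k + 1) = 0" by (simp add: axis_def)
    then show ?thesis by blast
  qed
  show "\<not> same_point (Cr_points p i) (Cr_points p j)"
  proof
    assume "same_point (Cr_points p i) (Cr_points p j)"
    then obtain c where c: "c \<noteq> 0" "\<And>l. Cr_points p j $ l = c * Cr_points p i $ l"
      by (auto simp: same_point_def)
    have "i \<le> 4 \<longleftrightarrow> j \<le> 4"
    proof -
      have "Cr_points p l = p l" if "l \<le> 4" for l using that by (simp add: Cr_points_def)
      moreover have "Cr_points p l $ n \<noteq> 0" if "\<not> l \<le> 4" "l \<in> {1..r}" for l n
        using gen that by simp
      ultimately show ?thesis using ax ij c by (metis mult_eq_0_iff)
    qed
    then consider "i \<le> 4" "j \<le> 4" | "\<not> i \<le> 4" "\<not> j \<le> 4" by blast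
    then have "same_point (p i) (p j)"
    proof cases
      case 1
      then show ?thesis using c by (auto simp: same_point_def Cr_points_def vec_eq_iff)
    next
      case 2
      then have "inverse (p j $ l) = c * inverse (p i $ l)" for l
        using c(2)[of l] by (simp add: Cr_points_def Cr_point_def)
      then have "p j $ l = inverse c * p i $ l" for l
        by (metis inverse_inverse_eq inverse_mult_distrib)
      then show ?thesis using c(1)
        by (auto simp: same_point_def vec_eq_iff intro!: exI[of _ "inverse c"])
    qed
    then show False using distinct_points ij by blast
  qed
qed

lemma prime_divisor_cases:
  assumes "v \<in> prime_divisors r p"
  obtains S d where "v = ord_along S" "prime_elem S" "homogeneous d S" "order_ge 1 S"
    | i where "v = mult_at (p i)" "i \<in> {1..r}"
  using assms order_ge_1_prime_form unfolding prime_divisors_def by blast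

lemma prime_divisor_mult:
  assumes "v \<in> prime_divisors r p" "F \<noteq> 0" "G \<noteq> 0" shows "v (F * G) = v F + v G"
  using assms(1) by (rule prime_divisor_cases) (simp_all add: assms ord_along_mult mult_at_mult)

text \<open>A disjunction is enough for uniqueness, which is symmetric; for a point and a surface,
  only a function vanishing at the point is constructed.\<close>

lemma prime_divisors_separated:
  assumes "v \<in> prime_divisors r p" "w \<in> prime_divisors r p" "v \<noteq> w"
  shows "separated v w \<or> separated w v"
  using assms(1)
proof (rule prime_divisor_cases)
  fix S d assume S: "v = ord_along S" "prime_elem S" "homogeneous d S" "order_ge 1 S"
  show ?thesis using assms(2)
  proof (rule prime_divisor_cases)
    fix T e assume T: "w = ord_along T" "prime_elem T" "homogeneous e T"
    then have "\<not> T dvd S" using ord_along_prime_cong S assms(3) by blast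
    then show ?thesis using separated_ord_ord S T by blast
  qed (use S separated_mult_ord point_neq_0 in blast)
next
  fix i assume i: "v = mult_at (p i)" "i \<in> {1..r}"
  show ?thesis using assms(2)
  proof (rule prime_divisor_cases)
    fix j assume j: "w = mult_at (p j)" "j \<in> {1..r}"
    then have "\<not> same_point (p i) (p j)" using i distinct_points assms(3) by blast
    then show ?thesis
      using separated_mult_mult[OF point_neq_0[OF i(2)] point_neq_0[OF j(2)]] i j by simp
  qed (use i separated_mult_ord point_neq_0 in blast)
qed

lemma Cr_transform_unique:
  assumes "w \<in> prime_divisors r p" "w' \<in> prime_divisors r p" "Cr_transform v w" "Cr_transform v w'"
  shows "w = w'"
proof (rule ccontr)
  assume "w \<noteq> w'"
  moreover have "\<not> separated u u'" if u: "Cr_transform v u" "Cr_transform v u'" for u u'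
    unfolding separated_def
  proof clarify
    fix d and F G :: "'a quaternary"
    assume "homogeneous d F" "homogeneous d G" "F \<noteq> 0" "G \<noteq> 0"
    then have "int (u F) - int (u G) = int (u' F) - int (u' G)"
      using u unfolding Cr_transform_def by metis
    moreover assume "u G < u F" "u' F \<le> u' G"
    ultimately show False by linarith
  qed
  ultimately show False using prime_divisors_separated assms by blast
qed

text \<open>Pulling back twice multiplies numerator and denominator by the same monomial, whose
  order along \<open>v\<close> cancels from the difference.\<close>

lemma Cr_transform_sym:
  assumes "v \<in> prime_divisors r p" "Cr_transform v w" shows "Cr_transform w v"
  unfolding Cr_transform_def
proof clarify
  fix d and F G :: "'a quaternary"
  assume h: "homogeneous d F" "homogeneous d G" and nz: "F \<noteq> 0" "G \<noteq> 0"
  then have "int (w (Cr_pullback F)) - int (w (Cr_pullback G)) =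
     int (v (Cr_pullback (Cr_pullback F))) - int (v (Cr_pullback (Cr_pullback G)))"
    using assms(2) homogeneous_Cr_pullback Cr_pullback_eq_0_iff unfolding Cr_transform_def by blast
  then show "int (v F) - int (v G) = int (w (Cr_pullback F)) - int (w (Cr_pullback G))"
    by (simp add: Cr_pullback_Cr_pullback[OF h(1)] Cr_pullback_Cr_pullback[OF h(2)]
        prime_divisor_mult[OF assms(1)] nz)
qed

lemma ord_along_X_mem: "ord_along (X i) \<in> prime_divisors r p"
  unfolding prime_divisors_def using prime_elem_X homogeneous_X by blast

lemma mult_at_axis_mem: "mult_at (axis i 1) \<in> prime_divisors r p"
  unfolding prime_divisors_def using point_index_mem coordinate_points by (metis (mono_tags, lifting) UnI2 mem_Collect_eq)

lemma Cr_transform_axis: "Cr_transform (mult_at (axis i (1::'a))) (ord_along (X i))"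
  by (rule Cr_transform_sym[OF ord_along_X_mem Cr_transform_X])

lemma Cr_transform_general:
  assumes "i \<in> {5..r}" shows "Cr_transform (mult_at (p i)) (mult_at (Cr_points p i))"
  using assms general_points[OF assms]
  by (intro Cr_transformI) (simp add: Cr_points_def mult_at_Cr_pullback)

lemma Cr_transform_exists:
  assumes "v \<in> prime_divisors r p"
  shows "\<exists>w\<in>prime_divisors r (Cr_points p). Cr_transform v w"
proof -
  interpret Cr: blown_up_points r "Cr_points p" by (rule blown_up_points_Cr)
  show ?thesis using assms
  proof (rule prime_divisor_cases)
    fix S d assume S: "v = ord_along S" "prime_elem S" "homogeneous d S" "order_ge 1 S"
    show ?thesis
    proof (cases "\<exists>i. X i dvd S")
      case True
      then obtain i where "v = ord_along (X i)"
        using ord_along_prime_cong[OF S(2) prime_elem_X] S(1) by blast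
      then show ?thesis using Cr_transform_X Cr.mult_at_axis_mem by blast
    next
      case False
      then obtain D T e where T: "reflects D S T" "homogeneous e T"
        using exists_reflects[OF _ S(3)] by blast
      have "Cr_transform v (ord_along T)"
        unfolding S(1) by (rule Cr_transformI)
          (simp add: Cr_pullback_eq_reflect ord_along_reflect[OF T(1) homogeneous_bounded_by])
      moreover have "ord_along T \<in> prime_divisors r (Cr_points p)"
        unfolding prime_divisors_def using prime_elem_reflects[OF T(1) S(2)] T(2) by blast
      ultimately show ?thesis by blast
    qed
  next
    fix i assume v: "v = mult_at (p i)" and i: "i \<in> {1..r}"
    from i show ?thesis
    proof (cases rule: point_cases)
      case (1 j)
      then show ?thesis using v Cr_transform_axis Cr.ord_along_X_mem by (metis coordinate_points)
    next
      case 2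
      then show ?thesis using v i Cr_transform_general[OF 2] unfolding prime_divisors_def by blast
    qed
  qed
qed

text \<open>On the prime divisors of the source, the contracted case of \<open>Cr_div\<close> never
  arises, so the strict transform can be named without a case distinction.\<close>

definition image_divisor :: "'a prime_divisor \<Rightarrow> 'a prime_divisor" where
  "image_divisor v = (THE w. w \<in> prime_divisors r (Cr_points p) \<and> Cr_transform v w)"

lemma image_divisor_eqI:
  assumes "w \<in> prime_divisors r (Cr_points p)" "Cr_transform v w" shows "image_divisor v = w"
  unfolding image_divisor_def using assms blown_up_points.Cr_transform_unique[OF blown_up_points_Cr]
  by (intro the_equality) blast+

lemma image_divisor:
  assumes "v \<in> prime_divisors r p"
  shows "image_divisor v \<in> prime_divisors r (Cr_points p)" "Cr_transform v (image_divisor v)"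
  using Cr_transform_exists[OF assms] image_divisor_eqI by metis+

lemma image_divisor_ord_along_X: "image_divisor (ord_along (X i)) = mult_at (axis i 1)"
  by (intro image_divisor_eqI blown_up_points.mult_at_axis_mem[OF blown_up_points_Cr] Cr_transform_X)

lemma image_divisor_axis: "image_divisor (mult_at (axis i 1)) = ord_along (X i)"
  by (intro image_divisor_eqI blown_up_points.ord_along_X_mem[OF blown_up_points_Cr] Cr_transform_axis)

lemma image_divisor_general:
  assumes "i \<in> {5..r}" shows "image_divisor (mult_at (p i)) = mult_at (Cr_points p i)"
proof (rule image_divisor_eqI[OF _ Cr_transform_general[OF assms]])
  show "mult_at (Cr_points p i) \<in> prime_divisors r (Cr_points p)"
    using assms unfolding prime_divisors_def by auto
qed

text \<open>The inverse is the same construction for \<open>Cr_points p\<close>, whose target is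
  \<open>p\<close> again because inverting coordinates is an involution; \<open>Cr_transform\<close>
  is symmetric.\<close>

lemma bij_betw_image_divisor:
  "bij_betw image_divisor (prime_divisors r p) (prime_divisors r (Cr_points p))"
proof -
  interpret Cr: blown_up_points r "Cr_points p" by (rule blown_up_points_Cr)
  have inv: "Cr_transform (image_divisor v) v" if "v \<in> prime_divisors r p" for v
    using image_divisor Cr_transform_sym that by blast
  have "inj_on image_divisor (prime_divisors r p)"
    using inv by (intro inj_onI) (metis Cr_transform_unique)
  moreover have "w \<in> image_divisor ` prime_divisors r p" if w: "w \<in> prime_divisors r (Cr_points p)" for w
  proof -
    obtain v where "v \<in> prime_divisors r p" "Cr_transform w v"
      using Cr.Cr_transform_exists[OF w] by auto
    then show ?thesis using Cr.Cr_transform_sym[OF w] image_divisor_eqI[OF w] by blast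
  qed
  ultimately show ?thesis using image_divisor(1) by (auto simp: bij_betw_def)
qed

end

section \<open>Divisors and the Picard group\<close>

text \<open>After one prime is split off, the others still divide the cofactor, because they do not
  divide that prime. No unique factorization enters.\<close>

lemma prod_primes_dvd:
  fixes F :: "'b::idom"
  assumes "finite A" "\<And>S. S \<in> A \<Longrightarrow> prime_elem S" "\<And>S. S \<in> A \<Longrightarrow> S dvd F"
    and "\<And>S T. S \<in> A \<Longrightarrow> T \<in> A \<Longrightarrow> S \<noteq> T \<Longrightarrow> \<not> T dvd S"
  shows "\<Prod>A dvd F"
  using assms
proof (induction A arbitrary: F rule: finite_induct)
  case (insert S A)
  obtain Q where Q: "F = S * Q" using insert.prems(2)[of S] by (auto elim: dvdE)
  have "\<Prod>A dvd Q"
  proof (rule insert.IH)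
    fix T assume "T \<in> A"
    then have "T dvd S * Q" "\<not> T dvd S" "prime_elem T"
      using insert.prems insert.hyps Q by auto
    then show "T dvd Q" by (simp add: prime_elem_dvd_mult_iff)
  qed (use insert.prems in auto)
  then show ?case using insert.hyps Q by (simp add: mult_dvd_mono)
qed simp

text \<open>Prime forms that divide \<open>F\<close> and define different divisors have a product
  that divides \<open>F\<close>. Each vanishes at the origin, so their number is bounded by the
  order of \<open>F\<close> there.\<close>

lemma finite_prime_divisors:
  fixes F :: "'a::field quaternary"
  assumes "F \<noteq> 0" shows "finite {v \<in> prime_divisors r p. v F \<noteq> 0}"
proof -
  define V where "V = {ord_along S | S d. prime_elem S \<and> homogeneous d S \<and> ord_along S F \<noteq> 0}"
  have "\<forall>v\<in>V. \<exists>S. v = ord_along S \<and> prime_elem S \<and> order_ge 1 S \<and> S dvd F"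
  proof
    fix v assume "v \<in> V"
    then obtain S d where S: "v = ord_along S" "prime_elem S" "homogeneous d S" "ord_along S F \<noteq> 0"
      unfolding V_def by blast
    have ge: "order_ge 1 S" by (rule order_ge_1_prime_form[OF S(2,3)])
    then have "S dvd F" using ord_along_eq_0_iff[OF assms ge] S(4) by simp
    then show "\<exists>S. v = ord_along S \<and> prime_elem S \<and> order_ge 1 S \<and> S dvd F" using S ge by blast
  qed
  then obtain g where g: "\<And>v. v \<in> V \<Longrightarrow> v = ord_along (g v)" "\<And>v. v \<in> V \<Longrightarrow> prime_elem (g v)"
      "\<And>v. v \<in> V \<Longrightarrow> order_ge 1 (g v)" "\<And>v. v \<in> V \<Longrightarrow> g v dvd F"
    by metis
  obtain b where b: "\<And>n. order_ge n F \<Longrightarrow> n \<le> b" using order_ge_bounded[OF assms] by blast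
  have "finite V"
  proof (rule ccontr)
    assume "infinite V"
    then obtain B where B: "B \<subseteq> V" "finite B" "card B = Suc b"
      using infinite_arbitrarily_large by blast
    have inj: "inj_on g B" by (rule inj_onI) (metis B(1) g(1) subsetD)
    have "\<Prod>(g ` B) dvd F"
    proof (rule prod_primes_dvd)
      fix S T assume "S \<in> g ` B" "T \<in> g ` B" "S \<noteq> T"
      then obtain u v where uv: "S = g u" "T = g v" "u \<in> V" "v \<in> V" "u \<noteq> v" using B by blast
      then show "\<not> T dvd S" using ord_along_prime_cong g(1,2) by metis
    qed (use B g in auto)
    then obtain Q where Q: "F = \<Prod>(g ` B) * Q" by (auto elim: dvdE)
    have "order_ge (\<Sum>S\<in>g ` B. 1) (\<Prod>S\<in>g ` B. S)"
      using B g(3) by (intro order_ge_prod) auto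
    moreover have "(\<Sum>S\<in>g ` B. 1) = Suc b" using B inj by (simp add: card_image)
    ultimately have "order_ge (Suc b + 0) F"
      unfolding Q by (intro order_ge_mult) auto
    then show False using b by force
  qed
  moreover have "{v \<in> prime_divisors r p. v F \<noteq> 0} \<subseteq> V \<union> (\<lambda>i. mult_at (p i)) ` {1..r}"
    unfolding prime_divisors_def V_def by blast
  ultimately show ?thesis by (meson finite_UnI finite_atLeastAtMost finite_imageI finite_subset)
qed

lemma lookup_total_transform:
  assumes "F \<noteq> 0"
  shows "Poly_Mapping.lookup (total_transform r p F) v = (if v \<in> prime_divisors r p then int (v F) else 0)"
proof -
  have "Poly_Mapping.lookup (total_transform r p F) v =
     (\<Sum>u | u \<in> prime_divisors r p \<and> u F \<noteq> 0. if u = v then int (u F) else 0)"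
    unfolding total_transform_def lookup_sum by (intro sum.cong) auto
  also have "\<dots> = (if v \<in> prime_divisors r p then int (v F) else 0)"
    by (subst sum.delta[OF finite_prime_divisors[OF assms]]) auto
  finally show ?thesis .
qed

lemma keys_total_transform: "F \<noteq> 0 \<Longrightarrow> Poly_Mapping.keys (total_transform r p F) \<subseteq> prime_divisors r p"
  by (auto simp: in_keys_iff lookup_total_transform split: if_splits)

lemma keys_principal_divisors:
  "D \<in> principal_divisors r p \<Longrightarrow> Poly_Mapping.keys D \<subseteq> prime_divisors r p"
  unfolding principal_divisors_def
  by (auto simp: in_keys_iff lookup_minus lookup_total_transform split: if_splits)

lemma principal_divisorsI:
  assumes "homogeneous d F" "homogeneous d G" "F \<noteq> 0" "G \<noteq> 0"
  shows "total_transform r p F - total_transform r p G \<in> principal_divisors r p"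
  using assms unfolding principal_divisors_def by blast

section \<open>Cosets and quotient groups\<close>

lemma mem_r_coset_Div:
  "D \<in> P #>\<^bsub>Div r p\<^esub> D0 \<longleftrightarrow> D - D0 \<in> P"
  unfolding r_coset_def Div_def by (auto simp: algebra_simps intro!: bexI[of _ "D - D0"])

lemma group_Div: "group (Div r p)" and mult_Div: "D \<otimes>\<^bsub>Div r p\<^esub> D' = D + D'"
  and mem_carrier_Div: "D \<in> carrier (Div r p) \<longleftrightarrow> Poly_Mapping.keys D \<subseteq> prime_divisors r p"
  by (simp_all add: Div_def)

lemma principal_divisors_subset: "principal_divisors r p \<subseteq> carrier (Div r p)"
  by (rule subsetI) (simp add: mem_carrier_Div keys_principal_divisors)

lemma image_r_coset:
  assumes "f \<in> hom G H" "N \<subseteq> carrier G" "a \<in> carrier G"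
  shows "f ` (N #>\<^bsub>G\<^esub> a) = f ` N #>\<^bsub>H\<^esub> f a"
proof -
  have "f ` (N #>\<^bsub>G\<^esub> a) = (\<lambda>h. f (h \<otimes>\<^bsub>G\<^esub> a)) ` N"
    by (auto simp: r_coset_def)
  also have "\<dots> = (\<lambda>h. f h \<otimes>\<^bsub>H\<^esub> f a) ` N"
    using assms by (intro image_cong) (auto simp: hom_mult)
  also have "\<dots> = f ` N #>\<^bsub>H\<^esub> f a" by (auto simp: r_coset_def)
  finally show ?thesis .
qed

text \<open>The quotient consists of cosets multiplied as sets. Translates and products of sets
  commute with images under \<open>f\<close>, and bijectivity passes to the cosets.\<close>

lemma image_iso_FactGroup:
  assumes "group G" and f: "f \<in> iso G H" and N: "N \<subseteq> carrier G" and N': "f ` N = N'"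
  shows "(\<lambda>C. f ` C) \<in> iso (G Mod N) (H Mod N')"
proof -
  interpret group G by fact
  have hom: "f \<in> hom G H" and bij: "bij_betw f (carrier G) (carrier H)"
    using f by (auto simp: iso_def)
  note coset = image_r_coset[OF hom N, unfolded N']
  have sub: "C \<subseteq> carrier G" if "C \<in> carrier (G Mod N)" for C
    using that N by (auto simp: FactGroup_def RCOSETS_def dest: r_coset_subset_G[THEN subsetD, rotated 2])
  have inj: "inj_on (\<lambda>C. f ` C) (carrier (G Mod N))"
    by (rule inj_onI) (metis bij bij_betw_imp_inj_on inj_on_image_eq_iff sub)
  have img: "(\<lambda>C. f ` C) ` carrier (G Mod N) = carrier (H Mod N')"
  proof -
    have "(\<lambda>C. f ` C) ` carrier (G Mod N) = (\<Union>a\<in>carrier G. {N' #>\<^bsub>H\<^esub> f a})"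
      by (simp add: FactGroup_def RCOSETS_def image_UN coset)
    also have "\<dots> = (\<Union>b\<in>f ` carrier G. {N' #>\<^bsub>H\<^esub> b})" by auto
    also have "\<dots> = carrier (H Mod N')"
      unfolding bij_betw_imp_surj_on[OF bij] by (simp add: FactGroup_def RCOSETS_def)
    finally show ?thesis .
  qed
  have "f ` (A <#>\<^bsub>G\<^esub> B) = f ` A <#>\<^bsub>H\<^esub> f ` B" if "A \<subseteq> carrier G" "B \<subseteq> carrier G" for A B
  proof -
    have "f ` (A <#>\<^bsub>G\<^esub> B) = (\<lambda>(a, b). f (a \<otimes>\<^bsub>G\<^esub> b)) ` (A \<times> B)"
      by (force simp: set_mult_def)
    also have "\<dots> = (\<lambda>(a, b). f a \<otimes>\<^bsub>H\<^esub> f b) ` (A \<times> B)"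
      using that by (intro image_cong) (auto simp: hom_mult[OF hom] subset_iff)
    also have "\<dots> = f ` A <#>\<^bsub>H\<^esub> f ` B" by (force simp: set_mult_def)
    finally show ?thesis .
  qed
  then have "(\<lambda>C. f ` C) \<in> hom (G Mod N) (H Mod N')"
    using img sub by (intro homI) (auto simp: FactGroup_def)
  then show ?thesis using inj img by (simp add: iso_def bij_betw_def)
qed

section \<open>Total transforms of coordinate planes\<close>

lemma mult_at_axis_X: "mult_at (axis j 1) (X i) = (if i = j then 0 else 1)"
proof -
  have "n \<le> mult_at (axis j 1) (X i) \<longleftrightarrow> n \<le> (if i = j then 0 else 1)" for n
    unfolding le_mult_at_axis_iff[OF homogeneous_X X_neq_0]
    by (auto simp: X_def lookup_single when_def)
  then show ?thesis by (intro antisym) blast+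
qed

lemma ord_along_X_X: "ord_along (X i) (X i) = 1"
proof -
  have "n \<le> ord_along (X i) (X i) \<longleftrightarrow> n \<le> 1" for n
    unfolding le_ord_along_iff[OF X_neq_0 order_ge_1_X] X_power_dvd_iff by (simp add: X_def)
  then show ?thesis by (intro antisym) blast+
qed

lemma separated_neq: "separated v w \<Longrightarrow> v \<noteq> w"
  by (auto simp: separated_def)

abbreviation plane_div :: "4 \<Rightarrow> 'a::field prime_divisor \<Rightarrow>\<^sub>0 int" where
  "plane_div i \<equiv> frag_of (ord_along (X i))"

abbreviation axis_div :: "4 \<Rightarrow> 'a::field prime_divisor \<Rightarrow>\<^sub>0 int" where
  "axis_div i \<equiv> frag_of (mult_at (axis i 1))"

text \<open>Read \<open>P i\<close> as the coordinate planes, \<open>E i\<close> as the exceptional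
  divisors over the coordinate points, and \<open>R\<close> as the part over the general points. The
  brackets on the right are differences of total transforms of planes. For
  \<open>i \<noteq> 0\<close>, \<open>P i\<close> occurs there in one bracket only, which forces the
  coefficient \<open>d - c i\<close>; those of \<open>P 0\<close> and \<open>E 0\<close> then agree
  by the value of \<open>k\<close>.\<close>

lemma divisor_identity:
  fixes P E :: "4 \<Rightarrow> 'b \<Rightarrow>\<^sub>0 int" and c :: "4 \<Rightarrow> int"
  assumes "k = 2 * d - (c 0 + c 1 + c 2 + c 3)"
  shows "frag_cmul d (E 0 + (P 1 + P 2 + P 3)) -
      (frag_cmul (c 0) (P 0) + frag_cmul (c 1) (P 1) + frag_cmul (c 2) (P 2) + frag_cmul (c 3) (P 3) + R) -
      (frag_cmul (d + k) (P 0 + (E 1 + E 2 + E 3)) -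
       (frag_cmul (c 0 + k) (E 0) + frag_cmul (c 1 + k) (E 1) + frag_cmul (c 2 + k) (E 2) + frag_cmul (c 3 + k) (E 3) + R)) =
    frag_cmul (d - c 1) (P 1 + (E 0 + E 2 + E 3) - (P 0 + (E 1 + E 2 + E 3))) +
    frag_cmul (d - c 2) (P 2 + (E 0 + E 1 + E 3) - (P 0 + (E 1 + E 2 + E 3))) +
    frag_cmul (d - c 3) (P 3 + (E 0 + E 1 + E 2) - (P 0 + (E 1 + E 2 + E 3)))"
  by (rule poly_mapping_eqI) (simp add: assms lookup_add lookup_minus algebra_simps)

context blown_up_points
begin

text \<open>The quotient of \<open>F / G\<close> by \<open>F' / G'\<close> is
  \<open>F G' / (G F')\<close>, and orders are additive on products.\<close>

lemma principal_divisors_diff: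
  assumes "D \<in> principal_divisors r p" "D' \<in> principal_divisors r p"
  shows "D - D' \<in> principal_divisors r p"
proof -
  obtain F G d where D: "D = total_transform r p F - total_transform r p G"
      "homogeneous d F" "homogeneous d G" "F \<noteq> 0" "G \<noteq> 0"
    using assms(1) unfolding principal_divisors_def by blast
  obtain F' G' d' where D': "D' = total_transform r p F' - total_transform r p G'"
      "homogeneous d' F'" "homogeneous d' G'" "F' \<noteq> 0" "G' \<noteq> 0"
    using assms(2) unfolding principal_divisors_def by blast
  have "D - D' = total_transform r p (F * G') - total_transform r p (G * F')"
    by (rule poly_mapping_eqI)
       (simp add: D D' lookup_minus lookup_total_transform prime_divisor_mult)
  then show ?thesis
    using principal_divisorsI[of "d + d'" "F * G'" "G * F'"] D D' by (simp add: homogeneous_mult)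
qed

lemma principal_divisors_0: "0 \<in> principal_divisors r p"
  using principal_divisorsI[of 0 1 1] by simp

lemma principal_divisors_add:
  assumes "D \<in> principal_divisors r p" "D' \<in> principal_divisors r p"
  shows "D + D' \<in> principal_divisors r p"
  using principal_divisors_diff[OF assms(1) principal_divisors_diff[OF principal_divisors_0 assms(2)]]
  by simp

lemma principal_divisors_cmul:
  "D \<in> principal_divisors r p \<Longrightarrow> frag_cmul c D \<in> principal_divisors r p"
  by (rule frag_closure_minus_cmul[where P = "\<lambda>D. D \<in> principal_divisors r p"])
     (auto intro: principal_divisors_diff principal_divisors_0)

lemma r_coset_eqI:
  assumes "D - D' \<in> principal_divisors r p"
  shows "principal_divisors r p #>\<^bsub>Div r p\<^esub> D = principal_divisors r p #>\<^bsub>Div r p\<^esub> D'"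
proof (rule Set.set_eqI)
  fix B
  have "B - D' = (B - D) + (D - D')" "B - D = (B - D') - (D - D')" by simp_all
  then show "B \<in> principal_divisors r p #>\<^bsub>Div r p\<^esub> D \<longleftrightarrow> B \<in> principal_divisors r p #>\<^bsub>Div r p\<^esub> D'"
    unfolding mem_r_coset_Div using assms principal_divisors_add principal_divisors_diff by metis
qed

text \<open>The plane passes simply through the three coordinate points other than the
  \<open>i\<close>-th and through no general point.\<close>

lemma total_transform_X:
  "total_transform r p (X i) = plane_div i + (\<Sum>j\<in>UNIV - {i}. axis_div j)"
proof (rule poly_mapping_eqI)
  fix v :: "'a prime_divisor"
  let ?rhs = "(if v = ord_along (X i) then 1 else 0) +
    (\<Sum>j\<in>UNIV - {i}. if v = mult_at (axis j 1) then 1 else 0 :: int)"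
  have axis_inj: "mult_at (axis j (1::'a)) = mult_at (axis l 1) \<longleftrightarrow> j = l" for j l
    using mult_at_axis_X[of j j] mult_at_axis_X[of l j] by (metis zero_neq_one)
  have neq: "ord_along S \<noteq> mult_at x" if "x \<noteq> 0" "order_ge 1 S" for S and x :: "'a ^ 4"
    using separated_neq[OF separated_mult_ord[OF that]] by simp
  have "(if v \<in> prime_divisors r p then int (v (X i)) else 0) = ?rhs"
  proof (cases "v \<in> prime_divisors r p")
    case True
    then show ?thesis
    proof (rule prime_divisor_cases)
      fix S d assume S: "v = ord_along S" "prime_elem S" "homogeneous d S" "order_ge 1 S"
      have "v \<noteq> mult_at (axis j 1)" for j
        using neq[OF _ S(4), of "axis j 1"] S(1) by (simp add: axis_eq_0_iff)
      moreover have "v (X i) = (if v = ord_along (X i) then 1 else 0)"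
      proof (cases "S dvd X i")
        case True
        then have "ord_along (X i) = v" using ord_along_prime_cong[OF prime_elem_X S(2)] S(1) by simp
        then show ?thesis using ord_along_X_X[where 'a = 'a, of i] by auto
      next
        case False
        then have "v (X i) = 0" using S by (simp add: ord_along_eq_0_iff)
        then show ?thesis using ord_along_X_X[where 'a = 'a, of i] by auto
      qed
      ultimately show ?thesis using True by simp
    next
      fix l assume v: "v = mult_at (p l)" and l: "l \<in> {1..r}"
      have ne: "v \<noteq> ord_along (X i)"
        using neq[OF point_neq_0[OF l] order_ge_1_X, of i] v by simp
      from l show ?thesis
      proof (cases rule: point_cases)
        case (1 j)
        then have vj: "v = mult_at (axis j 1)" using v coordinate_points by simp
        have "(\<Sum>l\<in>UNIV - {i}. if v = mult_at (axis l 1) then 1 else 0 :: int) = (if i = j then 0 else 1)"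
          unfolding vj axis_inj by (subst sum.delta') auto
        then show ?thesis using True ne by (simp add: vj mult_at_axis_X)
      next
        case 2
        have 0: "v (X j) = 0" for j
          unfolding v by (rule mult_at_X_eq_0[OF general_points[OF 2]])
        \<comment> \<open>The plane of \<open>X (j + 1)\<close> contains the \<open>j\<close>-th
          coordinate point but no general point.\<close>
        have "v \<noteq> mult_at (axis j 1)" for j
          using 0[of "j + 1"] mult_at_axis_X[where 'a = 'a, of j "j + 1"] by auto
        then show ?thesis using True ne 0 by simp
      qed
    qed
  next
    case False
    then have "v \<noteq> ord_along (X i)" "v \<noteq> mult_at (axis j 1)" for j
      using ord_along_X_mem mult_at_axis_mem by blast+
    then show ?thesis using False by simp
  qed
  then show "Poly_Mapping.lookup (total_transform r p (X i)) v =
      Poly_Mapping.lookup (plane_div i + (\<Sum>j\<in>UNIV - {i}. axis_div j)) v"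
    by (simp add: lookup_total_transform lookup_add lookup_sum)
qed

section \<open>Push-forward of divisors as a relabelling\<close>

lemma Cr_div_frag_of:
  assumes "v \<in> prime_divisors r p" shows "Cr_div r p (frag_of v) = frag_of (image_divisor v)"
  using Cr_transform_exists[OF assms] by (simp add: Cr_div_def image_divisor_def)

lemma Cr_div_eq:
  assumes "Poly_Mapping.keys D \<subseteq> prime_divisors r p"
  shows "Cr_div r p D = frag_extend (frag_of \<circ> image_divisor) D"
  unfolding Cr_div_def
  by (rule frag_extend_eq) (use assms Cr_transform_exists in \<open>auto simp: image_divisor_def\<close>)

lemma keys_Cr_div:
  assumes "Poly_Mapping.keys D \<subseteq> prime_divisors r p"
  shows "Poly_Mapping.keys (Cr_div r p D) \<subseteq> prime_divisors r (Cr_points p)"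
  using keys_frag_extend[of "frag_of \<circ> image_divisor" D] assms image_divisor(1)
  by (fastforce simp: Cr_div_eq)

text \<open>Since \<open>image_divisor\<close> is injective on prime divisors, no two terms of
  \<open>D\<close> merge under the push-forward.\<close>

lemma lookup_Cr_div:
  assumes "Poly_Mapping.keys D \<subseteq> prime_divisors r p" "v \<in> prime_divisors r p"
  shows "Poly_Mapping.lookup (Cr_div r p D) (image_divisor v) = Poly_Mapping.lookup D v"
proof -
  have "Poly_Mapping.lookup (Cr_div r p D) (image_divisor v) =
     (\<Sum>u\<in>Poly_Mapping.keys D. if u = v then Poly_Mapping.lookup D u else 0)"
    unfolding Cr_div_eq[OF assms(1)] frag_extend_def lookup_sum
  proof (rule sum.cong)
    fix u assume "u \<in> Poly_Mapping.keys D"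
    then have "image_divisor v = image_divisor u \<longleftrightarrow> u = v"
      using bij_betw_image_divisor assms by (auto simp: bij_betw_def inj_on_def)
    then show "Poly_Mapping.lookup (frag_cmul (Poly_Mapping.lookup D u) ((frag_of \<circ> image_divisor) u)) (image_divisor v) =
        (if u = v then Poly_Mapping.lookup D u else 0)" by simp
  qed simp
  then show ?thesis by (simp add: in_keys_iff)
qed

lemma Cr_div_eqI:
  assumes "Poly_Mapping.keys D \<subseteq> prime_divisors r p" "Poly_Mapping.keys D' \<subseteq> prime_divisors r (Cr_points p)"
    and "\<And>v. v \<in> prime_divisors r p \<Longrightarrow>
      Poly_Mapping.lookup D v = Poly_Mapping.lookup D' (image_divisor v)"
  shows "Cr_div r p D = D'"
proof (rule poly_mapping_eqI)
  fix w
  show "Poly_Mapping.lookup (Cr_div r p D) w = Poly_Mapping.lookup D' w"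
  proof (cases "w \<in> prime_divisors r (Cr_points p)")
    case True
    then obtain v where "v \<in> prime_divisors r p" "w = image_divisor v"
      using bij_betw_image_divisor by (auto simp: bij_betw_def)
    then show ?thesis using assms lookup_Cr_div by simp
  next
    case False
    then have "w \<notin> Poly_Mapping.keys (Cr_div r p D)" "w \<notin> Poly_Mapping.keys D'"
      using keys_Cr_div[OF assms(1)] assms(2) by blast+
    then show ?thesis by (simp add: in_keys_iff)
  qed
qed

lemma Cr_div_total_transform:
  assumes "F \<noteq> 0" "G \<noteq> 0" "F' \<noteq> 0" "G' \<noteq> 0"
    and "\<And>v. v \<in> prime_divisors r p \<Longrightarrow>
      int (v F) - int (v G) = int (image_divisor v F') - int (image_divisor v G')"
  shows "Cr_div r p (total_transform r p F - total_transform r p G) =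
    total_transform r (Cr_points p) F' - total_transform r (Cr_points p) G'"
proof (rule Cr_div_eqI)
  fix v assume "v \<in> prime_divisors r p"
  then show "Poly_Mapping.lookup (total_transform r p F - total_transform r p G) v =
    Poly_Mapping.lookup (total_transform r (Cr_points p) F' - total_transform r (Cr_points p) G') (image_divisor v)"
    using assms image_divisor(1) by (simp add: lookup_minus lookup_total_transform)
qed (use assms(1-4) in \<open>auto simp: in_keys_iff lookup_minus lookup_total_transform split: if_splits\<close>)

text \<open>Pulling back forms serves both inclusions: the divisor of \<open>F / G\<close> on the
  source goes to that of its pull-back, by symmetry of \<open>Cr_transform\<close>, and the divisor
  of \<open>F / G\<close> on the target comes from that of its pull-back.\<close>

lemma Cr_div_principal_divisors:
  "Cr_div r p ` principal_divisors r p = principal_divisors r (Cr_points p)"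
proof (intro equalityI subsetI)
  fix D assume "D \<in> Cr_div r p ` principal_divisors r p"
  then obtain F G d where D: "D = Cr_div r p (total_transform r p F - total_transform r p G)"
      "homogeneous d F" "homogeneous d G" "F \<noteq> 0" "G \<noteq> 0"
    unfolding principal_divisors_def by blast
  have nz: "Cr_pullback F \<noteq> 0" "Cr_pullback G \<noteq> 0" using D Cr_pullback_eq_0_iff by blast+
  have "D = total_transform r (Cr_points p) (Cr_pullback F) - total_transform r (Cr_points p) (Cr_pullback G)"
    unfolding D(1)
  proof (rule Cr_div_total_transform[OF D(4,5) nz])
    fix v assume v: "v \<in> prime_divisors r p"
    show "int (v F) - int (v G) = int (image_divisor v (Cr_pullback F)) - int (image_divisor v (Cr_pullback G))"
      using Cr_transform_sym[OF v image_divisor(2)[OF v]] D unfolding Cr_transform_def by blast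
  qed
  then show "D \<in> principal_divisors r (Cr_points p)"
    using principal_divisorsI[OF homogeneous_Cr_pullback homogeneous_Cr_pullback nz] D by blast
next
  fix D assume "D \<in> principal_divisors r (Cr_points p)"
  then obtain F G d where D: "D = total_transform r (Cr_points p) F - total_transform r (Cr_points p) G"
      "homogeneous d F" "homogeneous d G" "F \<noteq> 0" "G \<noteq> 0"
    unfolding principal_divisors_def by blast
  have nz: "Cr_pullback F \<noteq> 0" "Cr_pullback G \<noteq> 0" using D Cr_pullback_eq_0_iff by blast+
  have "Cr_div r p (total_transform r p (Cr_pullback F) - total_transform r p (Cr_pullback G)) = D"
    unfolding D(1)
  proof (rule Cr_div_total_transform[OF nz D(4,5)])
    fix v assume v: "v \<in> prime_divisors r p"
    show "int (v (Cr_pullback F)) - int (v (Cr_pullback G)) = int (image_divisor v F) - int (image_divisor v G)"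
      using image_divisor(2)[OF v] D unfolding Cr_transform_def by metis
  qed
  then show "D \<in> Cr_div r p ` principal_divisors r p"
    using principal_divisorsI[OF homogeneous_Cr_pullback homogeneous_Cr_pullback nz] D by blast
qed

lemma Cr_div_iso: "Cr_div r p \<in> iso (Div r p) (Div r (Cr_points p))"
proof -
  have hom: "Cr_div r p \<in> hom (Div r p) (Div r (Cr_points p))"
    by (rule homI) (simp_all add: mem_carrier_Div mult_Div keys_Cr_div, simp add: Cr_div_def frag_extend_add)
  have inj: "inj_on (Cr_div r p) (carrier (Div r p))"
  proof (rule inj_onI)
    fix D D' assume D: "D \<in> carrier (Div r p)" "D' \<in> carrier (Div r p)" "Cr_div r p D = Cr_div r p D'"
    show "D = D'"
    proof (rule poly_mapping_eqI)
      fix v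
      show "Poly_Mapping.lookup D v = Poly_Mapping.lookup D' v"
      proof (cases "v \<in> prime_divisors r p")
        case True
        then show ?thesis using lookup_Cr_div D unfolding mem_carrier_Div by metis
      next
        case False
        then have "v \<notin> Poly_Mapping.keys D" "v \<notin> Poly_Mapping.keys D'"
          using D unfolding mem_carrier_Div by blast+
        then show ?thesis by (simp add: in_keys_iff)
      qed
    qed
  qed
  have "D \<in> Cr_div r p ` carrier (Div r p)" if "D \<in> carrier (Div r (Cr_points p))" for D
  proof -
    have keys: "Poly_Mapping.keys D \<subseteq> prime_divisors r (Cr_points p)" using that by (simp add: mem_carrier_Div)
    \<comment> \<open>The preimage of \<open>D\<close> is \<open>D\<close> relabelled by the inverse
      bijection.\<close>
    define g where "g = the_inv_into (prime_divisors r p) image_divisor"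
    have g: "g w \<in> prime_divisors r p" "image_divisor (g w) = w" if "w \<in> prime_divisors r (Cr_points p)" for w
      using bij_betw_apply[OF bij_betw_the_inv_into[OF bij_betw_image_divisor] that]
        f_the_inv_into_f_bij_betw[OF bij_betw_image_divisor] that
      unfolding g_def by blast+
    define D0 where "D0 = frag_extend (frag_of \<circ> g) D"
    have "Poly_Mapping.keys D0 \<subseteq> prime_divisors r p"
      using keys_frag_extend[of "frag_of \<circ> g" D] keys g(1) unfolding D0_def by fastforce
    moreover have "Cr_div r p D0 = D"
    proof -
      have "Cr_div r p D0 = frag_extend (frag_of \<circ> image_divisor \<circ> g) D"
        unfolding D0_def
        by (subst Cr_div_eq) (use calculation frag_extend_compose[of "frag_of \<circ> image_divisor" g D] in \<open>simp_all add: D0_def\<close>)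
      also have "\<dots> = frag_extend frag_of D"
        using keys g(2) by (intro frag_extend_eq) auto
      finally show ?thesis by (simp flip: frag_expansion)
    qed
    ultimately show ?thesis by (auto simp: mem_carrier_Div)
  qed
  then show ?thesis using hom inj by (auto simp: iso_def bij_betw_def hom_def)
qed

lemma Cr_iso: "Cr r p \<in> iso (Pic r p) (Pic r (Cr_points p))"
proof -
  have "Cr r p = (\<lambda>C. Cr_div r p ` C)" by (rule ext) (simp add: Cr_def)
  then show ?thesis
    using image_iso_FactGroup[OF group_Div Cr_div_iso principal_divisors_subset Cr_div_principal_divisors]
    by (simp add: Pic_def)
qed

section \<open>Classes and linear systems\<close>

lemma exceptional_point_index: "exceptional p (point_index i) = axis_div i"
  by (simp add: exceptional_def coordinate_points)

lemma sum_points: "(\<Sum>i\<in>{1..r}. f i) = (\<Sum>i\<in>UNIV. f (point_index i)) + (\<Sum>i\<in>{5..r}. f i)"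
  for f :: "nat \<Rightarrow> 'b::comm_monoid_add"
proof -
  have "{1..r} = {1..4} \<union> {5..r}" using r_ge by auto
  then have "(\<Sum>i\<in>{1..r}. f i) = (\<Sum>i\<in>{1..4}. f i) + (\<Sum>i\<in>{5..r}. f i)"
    by (simp add: sum.union_disjoint)
  then show ?thesis by (simp add: sum.reindex_bij_betw[OF bij_betw_point_index])
qed

lemma keys_L3_divisor:
  "Poly_Mapping.keys (frag_cmul d (hyperplane r p) - (\<Sum>i\<in>{1..r}. frag_cmul (m i) (exceptional p i)))
     \<subseteq> prime_divisors r p" (is "Poly_Mapping.keys (?A - ?B) \<subseteq> _")
proof -
  have "Poly_Mapping.keys ?A \<subseteq> prime_divisors r p"
    unfolding hyperplane_def by (rule order_trans[OF keys_cmul keys_total_transform[OF X_neq_0]])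
  moreover have "Poly_Mapping.keys ?B \<subseteq> prime_divisors r p"
    by (rule order_trans[OF keys_sum]) (auto simp: exceptional_def prime_divisors_def split: if_splits)
  ultimately show ?thesis by (intro order_trans[OF keys_diff Un_least])
qed

lemma Cr_div_L3_divisor:
  assumes k: "k = 2 * d - (\<Sum>i\<in>{1..4}. m i)" and m': "m' = (\<lambda>i. if i \<le> 4 then m i + k else m i)"
  shows "Cr_div r p (frag_cmul d (hyperplane r p) - (\<Sum>i\<in>{1..r}. frag_cmul (m i) (exceptional p i))) -
     (frag_cmul (d + k) (hyperplane r (Cr_points p)) - (\<Sum>i\<in>{1..r}. frag_cmul (m' i) (exceptional (Cr_points p) i)))
     \<in> principal_divisors r (Cr_points p)" (is "Cr_div r p ?D - ?D' \<in> _")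
proof -
  interpret Cr: blown_up_points r "Cr_points p" by (rule blown_up_points_Cr)
  let ?h = "\<lambda>i. total_transform r (Cr_points p) (X i)"
  let ?R = "\<Sum>i\<in>{5..r}. frag_cmul (m i) (exceptional (Cr_points p) i)"
  let ?m = "\<lambda>i. m (point_index i)"
  have k': "k = 2 * d - (\<Sum>i\<in>UNIV. ?m i)"
    by (simp add: k sum.reindex_bij_betw[OF bij_betw_point_index])
  have plane: "Cr_div r p (plane_div i) = axis_div i" and axis: "Cr_div r p (axis_div i) = plane_div i" for i
    by (simp_all add: Cr_div_frag_of ord_along_X_mem mult_at_axis_mem image_divisor_ord_along_X image_divisor_axis)
  have general: "Cr_div r p (exceptional p i) = exceptional (Cr_points p) i" if "i \<in> {5..r}" for i
  proof -
    have "mult_at (p i) \<in> prime_divisors r p" using that unfolding prime_divisors_def by auto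
    then show ?thesis by (simp add: exceptional_def Cr_div_frag_of image_divisor_general[OF that])
  qed
  have linear: "Cr_div r p (D + D') = Cr_div r p D + Cr_div r p D'" "Cr_div r p (D - D') = Cr_div r p D - Cr_div r p D'"
    "Cr_div r p (frag_cmul c D) = frag_cmul c (Cr_div r p D)"
    "finite I \<Longrightarrow> Cr_div r p (sum f I) = (\<Sum>i\<in>I. Cr_div r p (f i))" for D D' c I and f :: "'i \<Rightarrow> _"
    by (simp_all add: Cr_div_def frag_extend_add frag_extend_diff frag_extend_cmul frag_extend_sum o_def)
  \<comment> \<open>\<open>H\<close> is one plane plus three exceptional divisors; each is exchanged
    with its partner, so the image is one exceptional divisor plus three planes.\<close>
  have "Cr_div r p (hyperplane r p) = axis_div 0 + (\<Sum>j\<in>UNIV - {0}. plane_div j)"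
    by (simp add: hyperplane_def total_transform_X linear plane axis)
  moreover have "Cr_div r p (\<Sum>i\<in>{1..r}. frag_cmul (m i) (exceptional p i)) = (\<Sum>i\<in>UNIV. frag_cmul (?m i) (plane_div i)) + ?R"
    unfolding sum_points by (simp add: linear exceptional_point_index axis general)
  ultimately have D: "Cr_div r p ?D = frag_cmul d (axis_div 0 + (\<Sum>j\<in>UNIV - {0}. plane_div j)) -
      ((\<Sum>i\<in>UNIV. frag_cmul (?m i) (plane_div i)) + ?R)"
    by (simp add: linear)
  have "m' (point_index i) = ?m i + k" for i using point_index_le by (simp add: m')
  moreover have "(\<Sum>i\<in>{5..r}. frag_cmul (m' i) (exceptional (Cr_points p) i)) = ?R"
    by (rule sum.cong) (auto simp: m')
  ultimately have D': "?D' = frag_cmul (d + k) (plane_div 0 + (\<Sum>j\<in>UNIV - {0}. axis_div j)) -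
      ((\<Sum>i\<in>UNIV. frag_cmul (?m i + k) (axis_div i)) + ?R)"
    unfolding sum_points by (simp add: Cr.exceptional_point_index hyperplane_def Cr.total_transform_X)
  have minus: "UNIV - {0} = {1, 2, 3 :: 4}" "UNIV - {1} = {0, 2, 3 :: 4}" "UNIV - {2} = {0, 1, 3 :: 4}"
    "UNIV - {3} = {0, 1, 2 :: 4}" unfolding UNIV_4_from_0 by auto
  have sums: "sum f UNIV = f 0 + f 1 + f 2 + f 3" "sum f (UNIV - {0}) = f 1 + f 2 + f 3"
    "sum f (UNIV - {1}) = f 0 + f 2 + f 3" "sum f (UNIV - {2}) = f 0 + f 1 + f 3"
    "sum f (UNIV - {3}) = f 0 + f 1 + f 2" for f :: "4 \<Rightarrow> 'b::comm_monoid_add"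
    unfolding minus unfolding UNIV_4_from_0 by (simp_all add: add.assoc)
  have k_sum: "k = 2 * d - (?m 0 + ?m 1 + ?m 2 + ?m 3)" by (simp add: k' sums)
  \<comment> \<open>This is the divisor of the product of the powers
    \<open>(X i / X 0) ^ (d - ?m i)\<close> for \<open>i = 1, 2, 3\<close>, where exponents may be
    negative.\<close>
  have "Cr_div r p ?D - ?D' = frag_cmul (d - ?m 1) (?h 1 - ?h 0) + frag_cmul (d - ?m 2) (?h 2 - ?h 0) +
      frag_cmul (d - ?m 3) (?h 3 - ?h 0)"
    unfolding D D' Cr.total_transform_X sums by (rule divisor_identity[OF k_sum])
  also have "\<dots> \<in> principal_divisors r (Cr_points p)"
    by (intro Cr.principal_divisors_add Cr.principal_divisors_cmul principal_divisorsI[of "Suc 0"]) simp_all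
  finally show ?thesis .
qed

lemma Cr_L3_class:
  assumes "k = 2 * d - (\<Sum>i\<in>{1..4}. m i)" "m' = (\<lambda>i. if i \<le> 4 then m i + k else m i)"
  shows "Cr r p (L3_class r p d m) = L3_class r (Cr_points p) (d + k) m'"
proof -
  let ?D = "frag_cmul d (hyperplane r p) - (\<Sum>i\<in>{1..r}. frag_cmul (m i) (exceptional p i))"
  have "Cr r p (L3_class r p d m) =
     principal_divisors r (Cr_points p) #>\<^bsub>Div r (Cr_points p)\<^esub> Cr_div r p ?D"
    unfolding Cr_def L3_class_def Cr_div_principal_divisors[symmetric]
    by (rule image_r_coset[OF _ principal_divisors_subset])
       (use Cr_div_iso keys_L3_divisor in \<open>simp_all only: iso_def mem_carrier_Div mem_Collect_eq\<close>)
  also have "\<dots> = L3_class r (Cr_points p) (d + k) m'"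
    unfolding L3_class_def
    by (rule blown_up_points.r_coset_eqI[OF blown_up_points_Cr Cr_div_L3_divisor[OF assms]])
  finally show ?thesis .
qed

text \<open>Coefficients are moved along a bijection of prime divisors and are zero elsewhere, so
  effectivity is preserved in both directions.\<close>

lemma Cr_div_nonneg_iff:
  assumes "Poly_Mapping.keys D \<subseteq> prime_divisors r p"
  shows "(\<forall>w. Poly_Mapping.lookup (Cr_div r p D) w \<ge> 0) \<longleftrightarrow> (\<forall>v. Poly_Mapping.lookup D v \<ge> 0)"
proof -
  have nonneg: "(\<forall>v. Poly_Mapping.lookup B v \<ge> 0) \<longleftrightarrow> (\<forall>v\<in>V. Poly_Mapping.lookup B v \<ge> 0)"
    if "Poly_Mapping.keys B \<subseteq> V" for B :: "'a prime_divisor \<Rightarrow>\<^sub>0 int" and V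
    using that by (metis in_keys_iff order_refl subsetD)
  have "prime_divisors r (Cr_points p) = image_divisor ` prime_divisors r p"
    using bij_betw_image_divisor by (simp add: bij_betw_def)
  then show ?thesis
    unfolding nonneg[OF assms] nonneg[OF keys_Cr_div[OF assms]] by (simp add: lookup_Cr_div[OF assms])
qed

lemma keys_L3_class: "D \<in> L3_class r p d m \<Longrightarrow> Poly_Mapping.keys D \<subseteq> prime_divisors r p"
  unfolding L3_class_def
proof -
  let ?D = "frag_cmul d (hyperplane r p) - (\<Sum>i\<in>{1..r}. frag_cmul (m i) (exceptional p i))"
  assume "D \<in> principal_divisors r p #>\<^bsub>Div r p\<^esub> ?D"
  then have "Poly_Mapping.keys (D - ?D) \<subseteq> prime_divisors r p"
    unfolding mem_r_coset_Div by (rule keys_principal_divisors)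
  then show ?thesis using keys_add[of "D - ?D" ?D] keys_L3_divisor[of d m] by auto
qed

lemma Cr_L3:
  assumes "k = 2 * d - (\<Sum>i\<in>{1..4}. m i)" "m' = (\<lambda>i. if i \<le> 4 then m i + k else m i)"
  shows "Cr r p (L3 r p d m) = L3 r (Cr_points p) (d + k) m'"
proof -
  have *: "f ` {x \<in> C. P x} = {y \<in> f ` C. Q y}" if "\<And>x. x \<in> C \<Longrightarrow> Q (f x) \<longleftrightarrow> P x"
    for f :: "'x \<Rightarrow> 'y" and C P Q using that by blast
  show ?thesis
    unfolding L3_def Cr_L3_class[OF assms, symmetric] unfolding Cr_def
    by (rule *, rule Cr_div_nonneg_iff, rule keys_L3_class)
qed

end

text \<open>An empty linear system keeps no trace of \<open>d\<close> and \<open>m\<close>, so the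
  formula is stated for classes as well as for linear systems.\<close>

theorem proposition2p1:
  fixes p :: "nat \<Rightarrow> 'a::field ^ 4" and r :: nat and d k :: int and m m' :: "nat \<Rightarrow> int"
  assumes "r \<ge> 4"
    and "p 1 = axis 0 1" and "p 2 = axis 1 1" and "p 3 = axis 2 1" and "p 4 = axis 3 1"
    and "\<And>i j. i \<in> {5..r} \<Longrightarrow> p i $ j \<noteq> 0"
    and "\<And>i j. i \<in> {1..r} \<Longrightarrow> j \<in> {1..r} \<Longrightarrow> i \<noteq> j \<Longrightarrow> \<not> same_point (p i) (p j)"
    and "k = 2 * d - (\<Sum>i\<in>{1..4}. m i)"
    and "m' = (\<lambda>i. if i \<le> 4 then m i + k else m i)"
  shows "Cr r p \<in> iso (Pic r p) (Pic r (Cr_points p)) \<and>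
      Cr r p (L3_class r p d m) = L3_class r (Cr_points p) (d + k) m' \<and>
      Cr r p (L3 r p d m) = L3 r (Cr_points p) (d + k) m'"
proof -
  have "p (point_index i) = axis i 1" for i
  proof -
    have "i \<in> {0, 1, 2, 3}" using UNIV_4_from_0 by blast
    then show ?thesis using assms(2-5) by (auto simp: point_index_def)
  qed
  then interpret blown_up_points r p by unfold_locales (use assms in blast)+
  show ?thesis using Cr_iso Cr_L3_class Cr_L3 assms(8,9) by blast
qed

end
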